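(* Let $G=\Delta(p,q,r)=\langle x,y\mid x^p=y^q=(xy)^r=1\rangle$ be a triangle group with $p$ prime and $p\le q\le r$. Let $\pi$ be a transitive permutation representation of $G$ on a finite set $\Omega$ of size $n>6$ such that $\pi(G)\cong\mathcal A_n$, and suppose $\pi$ has a $k$-handle $[a,b]_k$ for some $k$. Let $\pi_1,\dots,\pi_p$ be permutation representations of $G$ on pairwise disjoint sets $\Omega_1,\dots,\Omega_p$, each $\pi_i$ equivalent to $\pi$ via a bijection $f_i:\Omega\to\Omega_i$ (so $f_i(\omega^{\pi(g)})=f_i(\omega)^{\pi_i(g)}$ for all $\omega\in\Omega$, $g\in G$), and put $a_i=f_i(a)$, $b_i=f_i(b)$. Let $\mathcal U=\Omega_1\cup\dots\cup\Omega_p$, let $\phi:G\to\mathcal S(\mathcal U)$ be the permutation representation with $$\phi(x)=\pi_1(x)\cdots\pi_p(x)\circ(a_1,a_2,\dots,a_p)(b_p,b_{p-1},\dots,b_1),\qquad\phi(y)=\pi_1(y)\cdots\pi_p(y),$$ and let $H=\phi(G)$. Then either 1. $p\mid qr$, $p\mid n$ and $H\cong C_p\times\mathcal A_n$; or 2. $H\cong C_p^{\,n-1}\rtimes\mathcal A_n$. (It is not asserted that case 2 is excluded when $p\mid qr$ and $p\mid n$; it might occur even then.)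
   Context: $\mathcal S(X)$ is the group of all permutations of a set $X$, $\mathcal A_n$ is the alternating group of degree $n$, and $C_p$ is the cyclic group of order $p$. Permutations act on the right, $\omega^g$ is the image of $\omega$ under $g$, and products are composed left to right. For a permutation representation $\pi$ of $G=\Delta(p,q,r)$, a $k$-handle $[a,b]_k$ consists of two distinct points $a,b$, both fixed by $\pi(x)$, such that $(\pi(x)\pi(y))^k$ maps $a$ to $b$. In the union $\mathcal U$, each $\pi_i(g)$ is regarded as a permutation of $\mathcal U$ acting on $\Omega_i$ and fixing the remaining points. The permutations $\phi(x),\phi(y)$ satisfy the defining relations of $G$, and $\phi$ is the resulting (transitive) permutation representation of $G$ on $\mathcal U$. *)

theory Defs
  imports
    "HOL-Algebra.Sym_Groups"
    "HOL-Algebra.Product_Groups"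
    "HOL-Algebra.Bij"
    "HOL-Computational_Algebra.Primes"
    "HOL-Library.Disjoint_Sets"
begin

text \<open>
  A word is a list of letters; \<open>(s, True)\<close> stands for the generator \<open>s\<close> and
  \<open>(s, False)\<close> for its formal inverse. \<open>word_eq R\<close> is the congruence on words generated
  by free cancellation and by \<open>w = 1\<close> for the relators \<open>w \<in> R\<close>.
\<close>

inductive word_eq :: "('s \<times> bool) list set \<Rightarrow> ('s \<times> bool) list \<Rightarrow> ('s \<times> bool) list \<Rightarrow> bool"
  for R where
  refl: "word_eq R u u"
| sym: "word_eq R u v \<Longrightarrow> word_eq R v u"
| trans: "word_eq R u v \<Longrightarrow> word_eq R v w \<Longrightarrow> word_eq R u w"
| cancel: "word_eq R (u @ [(s, e), (s, \<not> e)] @ v) (u @ v)"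
| relator: "w \<in> R \<Longrightarrow> word_eq R (u @ w @ v) (u @ v)"

definition word_class :: "('s \<times> bool) list set \<Rightarrow> ('s \<times> bool) list \<Rightarrow> ('s \<times> bool) list set" where
  "word_class R u = {v. word_eq R u v}"

definition presented_group :: "('s \<times> bool) list set \<Rightarrow> ('s \<times> bool) list set monoid" where
  "presented_group R =
     \<lparr>carrier = range (word_class R),
      mult = (\<lambda>A B. \<Union>u\<in>A. \<Union>v\<in>B. word_class R (u @ v)),
      one = word_class R []\<rparr>"

lemma word_class_eq_iff: "word_class R u = word_class R v \<longleftrightarrow> word_eq R u v"
proof
  assume "word_class R u = word_class R v"
  then have "v \<in> word_class R u" by (simp add: word_class_def word_eq.refl)
  then show "word_eq R u v" by (simp add: word_class_def)
next
  assume "word_eq R u v"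
  then have "word_eq R u w \<longleftrightarrow> word_eq R v w" for w
    using word_eq.trans[of R u v w] word_eq.trans[of R v u w] word_eq.sym[of R u v] by blast
  then show "word_class R u = word_class R v" by (simp add: word_class_def)
qed

lemma word_eq_append_left: "word_eq R u v \<Longrightarrow> word_eq R (a @ u) (a @ v)"
proof (induction rule: word_eq.induct)
  case (cancel u s e v)
  show ?case using word_eq.cancel[of R "a @ u" s e v] by simp
next
  case (relator w u v)
  then show ?case using word_eq.relator[of w R "a @ u" v] by simp
qed (rule word_eq.refl, erule word_eq.sym, erule (1) word_eq.trans)

lemma word_eq_append_right: "word_eq R u v \<Longrightarrow> word_eq R (u @ b) (v @ b)"
proof (induction rule: word_eq.induct)
  case (cancel u s e v)
  show ?case using word_eq.cancel[of R u s e "v @ b"] by simp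
next
  case (relator w u v)
  then show ?case using word_eq.relator[of w R u "v @ b"] by simp
qed (rule word_eq.refl, erule word_eq.sym, erule (1) word_eq.trans)

lemma presented_group_mult:
  "word_class R u \<otimes>\<^bsub>presented_group R\<^esub> word_class R v = word_class R (u @ v)"
proof -
  have same: "word_class R (u' @ v') = word_class R (u @ v)"
    if u': "u' \<in> word_class R u" and v': "v' \<in> word_class R v" for u' v'
  proof -
    have "word_eq R (u @ v) (u' @ v)"
      by (rule word_eq_append_right) (use u' in \<open>simp add: word_class_def\<close>)
    moreover have "word_eq R (u' @ v) (u' @ v')"
      by (rule word_eq_append_left) (use v' in \<open>simp add: word_class_def\<close>)
    ultimately have "word_eq R (u' @ v') (u @ v)"
      by (rule word_eq.sym[OF word_eq.trans])
    then show ?thesis by (simp only: word_class_eq_iff)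
  qed
  have "u \<in> word_class R u" "v \<in> word_class R v"
    by (simp_all add: word_class_def word_eq.refl)
  then have "(\<Union>u'\<in>word_class R u. \<Union>v'\<in>word_class R v. word_class R (u' @ v'))
      = word_class R (u @ v)"
    using same by blast
  then show ?thesis by (simp add: presented_group_def)
qed

lemma word_eq_inverse: "word_eq R (rev (map (map_prod id Not) u) @ u) []"
proof (induction u)
  case Nil
  show ?case by (simp add: word_eq.refl)
next
  case (Cons l u)
  obtain s e where l: "l = (s, e)" by fastforce
  show ?case
    using word_eq.trans[OF word_eq.cancel[of R "rev (map (map_prod id Not) u)" s "\<not> e" u] Cons.IH]
    by (simp add: l id_def)
qed

lemma group_presented_group: "group (presented_group R)"
proof (rule groupI)
  fix A B C
  assume "A \<in> carrier (presented_group R)" "B \<in> carrier (presented_group R)"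
    "C \<in> carrier (presented_group R)"
  then obtain u v w where "A = word_class R u" "B = word_class R v" "C = word_class R w"
    by (auto simp: presented_group_def)
  then show "A \<otimes>\<^bsub>presented_group R\<^esub> B \<otimes>\<^bsub>presented_group R\<^esub> C
      = A \<otimes>\<^bsub>presented_group R\<^esub> (B \<otimes>\<^bsub>presented_group R\<^esub> C)"
    by (simp add: presented_group_mult)
next
  fix A assume "A \<in> carrier (presented_group R)"
  then obtain u where A: "A = word_class R u" by (auto simp: presented_group_def)
  have one: "\<one>\<^bsub>presented_group R\<^esub> = word_class R []" by (simp add: presented_group_def)
  show "\<one>\<^bsub>presented_group R\<^esub> \<otimes>\<^bsub>presented_group R\<^esub> A = A"
    by (simp add: A one presented_group_mult)
  have "word_class R (rev (map (map_prod id Not) u)) \<otimes>\<^bsub>presented_group R\<^esub> A = \<one>\<^bsub>presented_group R\<^esub>"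
    by (simp add: A one presented_group_mult word_class_eq_iff word_eq_inverse)
  moreover have "word_class R (rev (map (map_prod id Not) u)) \<in> carrier (presented_group R)"
    by (simp add: presented_group_def)
  ultimately show "\<exists>B\<in>carrier (presented_group R). B \<otimes>\<^bsub>presented_group R\<^esub> A = \<one>\<^bsub>presented_group R\<^esub>"
    by blast
next
  fix A B
  assume "A \<in> carrier (presented_group R)" "B \<in> carrier (presented_group R)"
  then obtain u v where "A = word_class R u" "B = word_class R v"
    by (auto simp: presented_group_def)
  then show "A \<otimes>\<^bsub>presented_group R\<^esub> B \<in> carrier (presented_group R)"
    by (simp add: presented_group_mult) (simp add: presented_group_def)
qed (simp add: presented_group_def)

datatype tri_gen = X | Y

definition triangle_relators :: "nat \<Rightarrow> nat \<Rightarrow> nat \<Rightarrow> (tri_gen \<times> bool) list set" where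
  "triangle_relators p q r =
     {replicate p (X, True), replicate q (Y, True),
      concat (replicate r [(X, True), (Y, True)])}"

definition triangle_group :: "nat \<Rightarrow> nat \<Rightarrow> nat \<Rightarrow> (tri_gen \<times> bool) list set monoid"
  (\<open>\<Delta>'(_,/ _,/ _')\<close>) where
  "\<Delta>(p, q, r) = presented_group (triangle_relators p q r)"

definition tri_x :: "nat \<Rightarrow> nat \<Rightarrow> nat \<Rightarrow> (tri_gen \<times> bool) list set" where
  "tri_x p q r = word_class (triangle_relators p q r) [(X, True)]"

definition tri_y :: "nat \<Rightarrow> nat \<Rightarrow> nat \<Rightarrow> (tri_gen \<times> bool) list set" where
  "tri_y p q r = word_class (triangle_relators p q r) [(Y, True)]"

lemma group_triangle_group: "group (\<Delta>(p, q, r))"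
  unfolding triangle_group_def by (rule group_presented_group)

text \<open>
  The symmetric group on \<open>S\<close>, acting on the right: the image of \<open>\<omega>\<close> under \<open>g\<close> is
  \<open>g \<omega>\<close>, and the product \<open>g \<otimes> h\<close> applies \<open>g\<close> first. Its elements are functions on the
  whole type that fix every point outside \<open>S\<close>; hence for \<open>S \<subseteq> T\<close> an element of \<open>Sym S\<close>
  \<^emph>\<open>is\<close> the corresponding element of \<open>Sym T\<close> fixing \<open>T - S\<close> pointwise.
\<close>

definition Sym :: "'a set \<Rightarrow> ('a \<Rightarrow> 'a) monoid" where
  "Sym S = \<lparr>carrier = {g. g permutes S}, mult = (\<lambda>g h. h \<circ> g), one = id\<rparr>"

lemma group_Sym: "group (Sym S)"
proof (rule groupI)
  fix g assume "g \<in> carrier (Sym S)"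
  then have "inv' g \<in> carrier (Sym S)" "inv' g \<otimes>\<^bsub>Sym S\<^esub> g = \<one>\<^bsub>Sym S\<^esub>"
    by (simp_all add: Sym_def permutes_inv permutes_inv_o(1))
  then show "\<exists>h\<in>carrier (Sym S). h \<otimes>\<^bsub>Sym S\<^esub> g = \<one>\<^bsub>Sym S\<^esub>" by blast
qed (simp_all add: Sym_def permutes_compose permutes_id comp_assoc)

definition perm_rep :: "('g, 'm) monoid_scheme \<Rightarrow> 'a set \<Rightarrow> ('g \<Rightarrow> 'a \<Rightarrow> 'a) \<Rightarrow> bool" where
  "perm_rep G S \<pi> \<longleftrightarrow> \<pi> \<in> hom G (Sym S)"

definition transitive_rep :: "('g, 'm) monoid_scheme \<Rightarrow> 'a set \<Rightarrow> ('g \<Rightarrow> 'a \<Rightarrow> 'a) \<Rightarrow> bool" where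
  "transitive_rep G S \<pi> \<longleftrightarrow>
     perm_rep G S \<pi> \<and> S \<noteq> {} \<and> (\<forall>\<alpha>\<in>S. \<forall>\<beta>\<in>S. \<exists>g\<in>carrier G. \<pi> g \<alpha> = \<beta>)"

definition image_group ::
  "('g, 'm) monoid_scheme \<Rightarrow> 'a set \<Rightarrow> ('g \<Rightarrow> 'a \<Rightarrow> 'a) \<Rightarrow> ('a \<Rightarrow> 'a) monoid" where
  "image_group G S \<pi> = (Sym S)\<lparr>carrier := \<pi> ` carrier G\<rparr>"

definition rep_equiv_via ::
  "('g, 'm) monoid_scheme \<Rightarrow> 'a set \<Rightarrow> ('g \<Rightarrow> 'a \<Rightarrow> 'a) \<Rightarrow> 'b set \<Rightarrow> ('g \<Rightarrow> 'b \<Rightarrow> 'b)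
    \<Rightarrow> ('a \<Rightarrow> 'b) \<Rightarrow> bool" where
  "rep_equiv_via G S \<pi> S' \<pi>' f \<longleftrightarrow>
     bij_betw f S S' \<and> (\<forall>\<omega>\<in>S. \<forall>g\<in>carrier G. f (\<pi> g \<omega>) = \<pi>' g (f \<omega>))"

definition is_handle :: "'a set \<Rightarrow> ('g \<Rightarrow> 'a \<Rightarrow> 'a) \<Rightarrow> 'g \<Rightarrow> 'g \<Rightarrow> nat \<Rightarrow> 'a \<Rightarrow> 'a \<Rightarrow> bool" where
  "is_handle S \<pi> x y k a b \<longleftrightarrow>
     a \<in> S \<and> b \<in> S \<and> a \<noteq> b \<and> \<pi> x a = a \<and> \<pi> x b = b \<and>
     ((\<pi> x \<otimes>\<^bsub>Sym S\<^esub> \<pi> y) [^]\<^bsub>Sym S\<^esub> k) a = b"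

definition list_mult :: "('g, 'm) monoid_scheme \<Rightarrow> 'g list \<Rightarrow> 'g" where
  "list_mult G gs = foldr (\<otimes>\<^bsub>G\<^esub>) gs \<one>\<^bsub>G\<^esub>"

text \<open>
  Composition in \<open>AutoGroup N\<close> is \<open>f \<otimes> g = f \<circ> g\<close>, so \<open>\<theta>\<close> is a left action of \<open>Q\<close> on \<open>N\<close>.
\<close>

definition semidirect_product ::
  "('n, 'k) monoid_scheme \<Rightarrow> ('q, 'm) monoid_scheme \<Rightarrow> ('q \<Rightarrow> 'n \<Rightarrow> 'n) \<Rightarrow> ('n \<times> 'q) monoid" where
  "semidirect_product N Q \<theta> =
     \<lparr>carrier = carrier N \<times> carrier Q,
      mult = (\<lambda>(m, g) (n, h). (m \<otimes>\<^bsub>N\<^esub> \<theta> g n, g \<otimes>\<^bsub>Q\<^esub> h)),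
      one = (\<one>\<^bsub>N\<^esub>, \<one>\<^bsub>Q\<^esub>)\<rparr>"

definition is_semidirect ::
  "('h, 'l) monoid_scheme \<Rightarrow> ('n, 'k) monoid_scheme \<Rightarrow> ('q, 'm) monoid_scheme \<Rightarrow> bool" where
  "is_semidirect H N Q \<longleftrightarrow>
     (\<exists>\<theta>\<in>hom Q (AutoGroup N). H \<cong> semidirect_product N Q \<theta>)"

end

theory Submission
  imports Defs "HOL-Number_Theory.Cong"
begin

text \<open>
  Label the points of the union \<open>U\<close> of the \<open>p\<close> copies by \<open>F j \<omega>\<close>, where \<open>j\<close> is an integer modulo
  \<open>p\<close> naming the copy and \<open>\<omega> \<in> \<Omega>\<close>. The copies of \<open>\<pi>(x)\<close> and \<open>\<pi>(y)\<close> do not change \<open>j\<close>, and the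
  two \<open>p\<close>-cycles raise \<open>j\<close> by one over \<open>a\<close> and lower it by one over \<open>b\<close>. Hence every \<open>\<phi>(g)\<close> has the form
  \<open>F j \<omega> \<mapsto> F (j + c \<omega>) (\<pi>(g) \<omega>)\<close> with a shift function \<open>c : \<Omega> \<rightarrow> \<int>/p\<close> of sum zero: \<open>H\<close> lies in the
  wreath product of \<open>C\<^sub>p\<close> with \<open>P = \<pi>(G)\<close>, and it maps onto \<open>P\<close> with a kernel \<open>K\<close> that consists of
  sum-zero functions and is stable under \<open>P\<close>. As \<open>P\<close> has the order of \<open>\<A>\<^sub>n\<close>, it has
  index two in the symmetric group, so it contains all squares and with them all 3-cycles.

  Suppose that some \<open>c \<in> K\<close> is not constant. Two differences \<open>c \<circ> t - c\<close> with 3-cycles \<open>t\<close> produce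
  a function with values \<open>1\<close> and \<open>-1\<close> at two points and \<open>0\<close> elsewhere, and its translates span all
  sum-zero functions (\<open>kernel_contains_sum_zero\<close>). Then \<open>H\<close> contains every sum-zero lift of every element
  of \<open>P\<close>, and the lifts with \<open>c = 0\<close> form a complement of \<open>K \<cong> C\<^sub>p\<^sup>n\<^sup>-\<^sup>1\<close>
  (\<open>full_kernel_semidirect\<close>).

  Suppose that all of \<open>K\<close> is constant. The shift functions then form a cocycle of \<open>P\<close> modulo constants,
  and the main point is that it is a coboundary (\<open>lifts_are_coboundaries\<close>); this replaces a computation of
  cohomology, and all of \<open>n > 6\<close> is used here. A 3-cycle \<open>t\<close> commutes with the 3-cycles of its fixed points, of
  which there are at least four, so a lift of \<open>t\<close> shifts all fixed points of \<open>t\<close> equally and can be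
  normalized to fix the points over them. For the normalized lift of \<open>t = (\<alpha> \<beta> \<gamma>)\<close> the shift at \<open>\<alpha>\<close>
  depends on \<open>\<alpha>\<close> and \<open>\<beta>\<close> only, and it has the form \<open>d \<beta> - d \<alpha>\<close> because the lift has
  order three and its inverse is normalized too. As normalized
  lifts are conjugated to normalized lifts, any lift \<open>(c, g)\<close> satisfies
  \<open>c \<omega> = d (g \<omega>) - d \<omega> + \<chi>\<close> with \<open>\<chi>\<close> independent of \<open>\<omega>\<close>. So \<open>G\<close> has a character \<open>\<chi>\<close> into \<open>C\<^sub>p\<close>, and
  evaluating at \<open>x\<close> and its fixed point \<open>a\<close> gives \<open>\<chi>(x) = 1\<close>. The image of \<open>G\<close> in \<open>C\<^sub>p \<times> P\<close> under
  \<open>(\<chi>, \<pi>)\<close> is everything, since \<open>P\<close> is perfect, and it is isomorphic to \<open>H\<close>. The nonzero constants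
  in \<open>K\<close> have sum zero, whence \<open>p\<close> divides \<open>n\<close>, and a character with \<open>\<chi>(x) \<noteq> 0\<close> forces \<open>p\<close> to divide \<open>q r\<close>
  (\<open>triangle_character_at_x\<close>).
\<close>

section \<open>Lifts of permutations to a cyclic cover\<close>

(* Keeps 3-cycles folded, so that three_cycle_apply and inv_three_cycle can rewrite them. *)
declare cycle_of_list.simps [simp del]

lemma three_cycle_apply:
  assumes "distinct [\<alpha>, \<beta>, \<gamma>]"
  shows "cycle_of_list [\<alpha>, \<beta>, \<gamma>] \<omega> =
    (if \<omega> = \<alpha> then \<beta> else if \<omega> = \<beta> then \<gamma> else if \<omega> = \<gamma> then \<alpha> else \<omega>)"
  using assms by (auto simp: cycle_of_list.simps transpose_def)

lemma inv_three_cycle: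
  assumes "distinct [\<alpha>, \<beta>, \<gamma>]"
  shows "inv' (cycle_of_list [\<alpha>, \<beta>, \<gamma>]) = cycle_of_list [\<beta>, \<alpha>, \<gamma>]"
  using assms by (intro inv_unique_comp ext) (auto simp: three_cycle_apply split: if_splits)

lemma conjugate_three_cycle:
  assumes "distinct [\<alpha>, \<beta>, \<gamma>]" "bij g"
  shows "g \<circ> cycle_of_list [\<alpha>, \<beta>, \<gamma>] \<circ> inv' g = cycle_of_list [g \<alpha>, g \<beta>, g \<gamma>]"
  using conjugation_of_cycle[of "[\<alpha>, \<beta>, \<gamma>]" g] assms by simp

text \<open>
  A pair \<open>(c, g)\<close> stands for the permutation \<open>(j, \<omega>) \<mapsto> (j + c \<omega>, g \<omega>)\<close> of \<open>\<int>/p \<times> \<Omega>\<close>, and \<open>realized\<close>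
  singles out a group of such permutations. Shifts are integers that matter modulo \<open>p\<close>, on \<open>\<Omega>\<close> only; this is
  the assumption \<open>reduce\<close>. The assumption \<open>compose\<close> describes acting by \<open>(c, g)\<close> first and by \<open>(d, h)\<close> second.
\<close>

locale twisted_lifts =
  fixes \<Omega> :: "'a set" and p :: nat and realized :: "('a \<Rightarrow> int) \<Rightarrow> ('a \<Rightarrow> 'a) \<Rightarrow> bool"
  assumes finite: "finite \<Omega>" and card_gt: "card \<Omega> > 6"
    and permutes: "realized c g \<Longrightarrow> g permutes \<Omega>"
    and reduce: "realized c g \<Longrightarrow> (\<And>\<omega>. \<omega> \<in> \<Omega> \<Longrightarrow> [c \<omega> = c' \<omega>] (mod int p)) \<Longrightarrow> realized c' g"
    and compose: "realized c g \<Longrightarrow> realized d h \<Longrightarrow> realized (\<lambda>\<omega>. c \<omega> + d (g \<omega>)) (h \<circ> g)"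
    and inverse: "realized c g \<Longrightarrow> realized (\<lambda>\<omega>. - c (inv' g \<omega>)) (inv' g)"
    and three_cycle: "distinct [\<alpha>, \<beta>, \<gamma>] \<Longrightarrow> {\<alpha>, \<beta>, \<gamma>} \<subseteq> \<Omega> \<Longrightarrow> \<exists>c. realized c (cycle_of_list [\<alpha>, \<beta>, \<gamma>])"
begin

lemma fresh_point:
  assumes "length xs \<le> 6"
  obtains \<delta> where "\<delta> \<in> \<Omega>" "\<delta> \<notin> set xs"
proof -
  have "card (set xs) < card \<Omega>"
    using card_length[of xs] assms card_gt by linarith
  then have "\<not> \<Omega> \<subseteq> set xs"
    using card_mono[of "set xs" \<Omega>] by auto
  then show ?thesis
    using that by blast
qed

section \<open>Kernels containing a nonconstant function\<close>

lemma kernel_diff: "realized c id \<Longrightarrow> realized d id \<Longrightarrow> realized (\<lambda>\<omega>. c \<omega> - d \<omega>) id"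
  using compose[of c id "\<lambda>\<omega>. - d \<omega>" id] inverse[of d id] by (simp add: inv_id[unfolded id_def])

lemma kernel_zero: "realized (\<lambda>_. 0) id"
proof -
  obtain \<alpha> where a: "\<alpha> \<in> \<Omega>" by (rule fresh_point[of "[]"]) auto
  obtain \<beta> where b: "\<beta> \<in> \<Omega>" "\<beta> \<noteq> \<alpha>" by (rule fresh_point[of "[\<alpha>]"]) auto
  obtain \<gamma> where c: "\<gamma> \<in> \<Omega>" "\<gamma> \<noteq> \<alpha>" "\<gamma> \<noteq> \<beta>" by (rule fresh_point[of "[\<alpha>, \<beta>]"]) auto
  obtain e where e: "realized e (cycle_of_list [\<alpha>, \<beta>, \<gamma>])"
    using three_cycle[of \<alpha> \<beta> \<gamma>] a b c by auto
  have "cycle_of_list [\<alpha>, \<beta>, \<gamma>] permutes \<Omega>" using permutes e by blast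
  then show ?thesis
    using compose[OF e inverse[OF e]] by (simp add: permutes_inverses permutes_inv_o)
qed

lemma kernel_add: "realized c id \<Longrightarrow> realized d id \<Longrightarrow> realized (\<lambda>\<omega>. c \<omega> + d \<omega>) id"
  using compose[of c id d id] by simp

lemma kernel_scale: "realized c id \<Longrightarrow> realized (\<lambda>\<omega>. int m * c \<omega>) id"
proof (induction m)
  case 0
  show ?case using kernel_zero by (simp add: id_def)
next
  case (Suc m)
  then show ?case using kernel_add[of c "\<lambda>\<omega>. int m * c \<omega>"] by (simp add: algebra_simps id_def)
qed

lemma kernel_sum:
  assumes "finite S" "\<And>s. s \<in> S \<Longrightarrow> realized (c s) id"
  shows "realized (\<lambda>\<omega>. \<Sum>s\<in>S. c s \<omega>) id"
  using assms
proof (induction S)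
  case empty
  show ?case using kernel_zero by (simp add: id_def)
next
  case (insert s S)
  then show ?case using kernel_add[of "c s" "\<lambda>\<omega>. \<Sum>s\<in>S. c s \<omega>"] by (simp add: id_def)
qed

lemma kernel_permute:
  assumes "realized c id" "realized e g"
  shows "realized (\<lambda>\<omega>. c (g \<omega>)) id"
proof -
  have g: "g permutes \<Omega>" using permutes assms by blast
  show ?thesis
    using compose[OF compose[OF assms(2,1)] inverse[OF assms(2)]] g
    by (simp add: permutes_inverses permutes_inv_o)
qed

lemma kernel_permute_three_cycle:
  assumes "realized c id" "distinct [\<alpha>, \<beta>, \<gamma>]" "{\<alpha>, \<beta>, \<gamma>} \<subseteq> \<Omega>"
  shows "realized (\<lambda>\<omega>. c (cycle_of_list [\<alpha>, \<beta>, \<gamma>] \<omega>)) id"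
  using kernel_permute[OF assms(1)] three_cycle[OF assms(2,3)] by blast

text \<open>
  The dichotomy for submodules of the permutation module of \<open>\<Omega>\<close> over the field with \<open>p\<close> elements: if one
  contains a nonconstant function, it contains the differences of any two basis vectors, which span the sum-zero functions.
\<close>

lemma kernel_contains_sum_zero:
  assumes p: "prime p" and c: "realized c id" "\<alpha> \<in> \<Omega>" "\<beta> \<in> \<Omega>" "\<not> [c \<alpha> = c \<beta>] (mod int p)"
    and sum: "[(\<Sum>\<omega>\<in>\<Omega>. d \<omega>) = 0] (mod int p)"
  shows "realized d id"
proof -
  have ab: "\<alpha> \<noteq> \<beta>" using c by auto
  obtain \<gamma> where g: "\<gamma> \<in> \<Omega>" "\<gamma> \<notin> {\<alpha>, \<beta>}" by (rule fresh_point[of "[\<alpha>, \<beta>]"]) auto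
  obtain \<delta> where d: "\<delta> \<in> \<Omega>" "\<delta> \<notin> {\<alpha>, \<beta>, \<gamma>}" by (rule fresh_point[of "[\<alpha>, \<beta>, \<gamma>]"]) auto
  obtain \<epsilon> where e: "\<epsilon> \<in> \<Omega>" "\<epsilon> \<notin> {\<alpha>, \<beta>, \<gamma>, \<delta>}"
    by (rule fresh_point[of "[\<alpha>, \<beta>, \<gamma>, \<delta>]"]) auto
  define u where "u = c \<beta> - c \<alpha>"
  \<comment> \<open>A function supported on three points, with value u at the first of them.\<close>
  define v where "v = (\<lambda>\<omega>. c (cycle_of_list [\<alpha>, \<beta>, \<gamma>] \<omega>) - c \<omega>)"
  have v: "realized v id"
    unfolding v_def using ab g c by (intro kernel_diff kernel_permute_three_cycle) auto
  \<comment> \<open>The second 3-cycle meets that support in the first point only, so u survives at two points.\<close>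
  define w where "w = (\<lambda>\<omega>. v (cycle_of_list [\<alpha>, \<delta>, \<epsilon>] \<omega>) - v \<omega>)"
  have w: "realized w id"
    unfolding w_def using ab g d e c v by (intro kernel_diff kernel_permute_three_cycle) auto
  have w_eq: "w = (\<lambda>\<omega>. u * (of_bool (\<omega> = \<epsilon>) - of_bool (\<omega> = \<alpha>)))"
    using ab g d e by (auto simp: w_def v_def u_def three_cycle_apply fun_eq_iff)
  \<comment> \<open>Scaling by an inverse of u modulo p gives a difference of two basis vectors.\<close>
  have "coprime u (int p)"
    using c(4) p
    by (metis cong_iff_dvd_diff cong_sym_eq coprime_commute prime_imp_coprime prime_nat_int_transfer u_def)
  then obtain m where m: "[u * m = 1] (mod int p)"
    using cong_solve_coprime_int by blast
  obtain m' where m': "[int m' = m] (mod int p)"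
    using p by (metis cong_mod_left cong_refl int_nat_eq mod_int_pos_iff of_nat_0_le_iff prime_gt_0_nat of_nat_0_less_iff pos_mod_sign)
  have "realized (\<lambda>\<omega>. of_bool (\<omega> = \<epsilon>) - of_bool (\<omega> = \<alpha>)) id"
  proof (rule reduce[OF kernel_scale[OF w, of m']])
    fix \<omega>
    show "[int m' * w \<omega> = of_bool (\<omega> = \<epsilon>) - of_bool (\<omega> = \<alpha>)] (mod int p)"
      using m m' unfolding w_eq cong_iff_dvd_diff by algebra
  qed
  then have basic: "realized (\<lambda>\<omega>. of_bool (\<omega> = \<mu>) - of_bool (\<omega> = \<alpha>)) id" if mu: "\<mu> \<in> \<Omega> - {\<alpha>}" for \<mu>
  proof (cases "\<mu> = \<epsilon>")
    case False
    obtain \<nu> where n: "\<nu> \<in> \<Omega>" "\<nu> \<notin> {\<alpha>, \<mu>, \<epsilon>}" by (rule fresh_point[of "[\<alpha>, \<mu>, \<epsilon>]"]) auto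
    have *: "distinct [\<mu>, \<epsilon>, \<nu>]" "{\<mu>, \<epsilon>, \<nu>} \<subseteq> \<Omega>" using False mu n e by auto
    have "(\<lambda>\<omega>. of_bool (cycle_of_list [\<mu>, \<epsilon>, \<nu>] \<omega> = \<epsilon>)
              - of_bool (cycle_of_list [\<mu>, \<epsilon>, \<nu>] \<omega> = \<alpha>))
        = (\<lambda>\<omega>. of_bool (\<omega> = \<mu>) - of_bool (\<omega> = \<alpha>) :: int)"
      using * mu n e by (auto simp: three_cycle_apply fun_eq_iff)
    then show ?thesis
      using kernel_permute_three_cycle[OF \<open>realized (\<lambda>\<omega>. of_bool (\<omega> = \<epsilon>) - of_bool (\<omega> = \<alpha>)) id\<close> *] by simp
  qed simp
  have multiple: "realized (\<lambda>\<omega>. d \<mu> * (of_bool (\<omega> = \<mu>) - of_bool (\<omega> = \<alpha>))) id" if "\<mu> \<in> \<Omega> - {\<alpha>}" for \<mu>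
  proof -
    have "[int (nat (d \<mu> mod int p)) = d \<mu>] (mod int p)"
      using p prime_gt_0_nat[OF p] by simp
    then show ?thesis
      by (intro reduce[OF kernel_scale[OF basic[OF that], of "nat (d \<mu> mod int p)"]] cong_scalar_right)
  qed
  have "realized (\<lambda>\<omega>. \<Sum>\<mu>\<in>\<Omega> - {\<alpha>}. d \<mu> * (of_bool (\<omega> = \<mu>) - of_bool (\<omega> = \<alpha>))) id"
    using finite multiple by (intro kernel_sum) auto
  then show ?thesis
  proof (rule reduce)
    fix \<omega> assume om: "\<omega> \<in> \<Omega>"
    show "[(\<Sum>\<mu>\<in>\<Omega> - {\<alpha>}. d \<mu> * (of_bool (\<omega> = \<mu>) - of_bool (\<omega> = \<alpha>))) = d \<omega>] (mod int p)"
    proof (cases "\<omega> = \<alpha>")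
      case True
      have "(\<Sum>\<mu>\<in>\<Omega> - {\<alpha>}. d \<mu> * (of_bool (\<alpha> = \<mu>) - of_bool (\<alpha> = \<alpha>))) = (\<Sum>\<mu>\<in>\<Omega> - {\<alpha>}. - d \<mu>)"
        by (intro sum.cong) auto
      also have "\<dots> = d \<alpha> - (\<Sum>\<mu>\<in>\<Omega>. d \<mu>)"
        using finite om True by (simp add: sum_negf sum.remove[of \<Omega> \<alpha>])
      finally show ?thesis
        using sum True by (simp add: cong_iff_dvd_diff)
    next
      case False
      have "(\<Sum>\<mu>\<in>\<Omega> - {\<alpha>}. d \<mu> * (of_bool (\<omega> = \<mu>) - of_bool (\<omega> = \<alpha>)))
          = (\<Sum>\<mu>\<in>\<Omega> - {\<alpha>}. if \<mu> = \<omega> then d \<mu> else 0)"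
        using False by (intro sum.cong) auto
      also have "\<dots> = d \<omega>" using finite om False by simp
      finally show ?thesis by simp
    qed
  qed
qed

section \<open>Kernels consisting of constants\<close>

text \<open>
  Adjoining the constant shifts, which are central, gives room to normalize lifts of 3-cycles. The shift
  function of a lift then matters up to an additive constant only.
\<close>

definition realized_mod :: "('a \<Rightarrow> int) \<Rightarrow> ('a \<Rightarrow> 'a) \<Rightarrow> bool" where
  "realized_mod c g \<longleftrightarrow> (\<exists>z. realized (\<lambda>\<omega>. c \<omega> + z) g)"

lemma realized_imp_realized_mod: "realized c g \<Longrightarrow> realized_mod c g"
  unfolding realized_mod_def by (rule exI[of _ 0]) simp

lemma realized_mod_permutes: "realized_mod c g \<Longrightarrow> g permutes \<Omega>"
  unfolding realized_mod_def using permutes by blast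

lemma realized_mod_shift: "realized_mod c g \<Longrightarrow> realized_mod (\<lambda>\<omega>. c \<omega> + z) g"
proof -
  assume "realized_mod c g"
  then obtain w where "realized (\<lambda>\<omega>. c \<omega> + w) g" unfolding realized_mod_def by blast
  then show ?thesis unfolding realized_mod_def by (intro exI[of _ "w - z"]) simp
qed

lemma realized_mod_compose: assumes "realized_mod c g" "realized_mod d h" shows "realized_mod (\<lambda>\<omega>. c \<omega> + d (g \<omega>)) (h \<circ> g)"
proof -
  obtain z w where "realized (\<lambda>\<omega>. c \<omega> + z) g" "realized (\<lambda>\<omega>. d \<omega> + w) h" using assms unfolding realized_mod_def by blast
  from compose[OF this] show ?thesis
    unfolding realized_mod_def by (intro exI[of _ "z + w"]) (simp add: algebra_simps)
qed

lemma realized_mod_inverse: assumes "realized_mod c g" shows "realized_mod (\<lambda>\<omega>. - c (inv' g \<omega>)) (inv' g)"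
proof -
  obtain z where "realized (\<lambda>\<omega>. c \<omega> + z) g" using assms unfolding realized_mod_def by blast
  from inverse[OF this] show ?thesis
    unfolding realized_mod_def by (intro exI[of _ "- z"]) (simp add: algebra_simps)
qed

lemma realized_mod_quotient:
  assumes "realized_mod c g" "realized_mod d h"
  shows "realized_mod (\<lambda>\<omega>. c \<omega> - d (inv' h (g \<omega>))) (inv' h \<circ> g)"
  using realized_mod_compose[OF assms(1) realized_mod_inverse[OF assms(2)]] by simp

lemma realized_mod_conjugate:
  assumes "realized_mod e g" "realized_mod c h"
  shows "realized_mod (\<lambda>\<omega>. - e (inv' g \<omega>) + c (inv' g \<omega>) + e (h (inv' g \<omega>))) (g \<circ> h \<circ> inv' g)"
  using realized_mod_compose[OF realized_mod_compose[OF realized_mod_inverse[OF assms(1)] assms(2)] assms(1)] by (simp add: comp_assoc)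

context
  assumes kernel_constant:
    "\<And>c \<alpha> \<beta>. realized c id \<Longrightarrow> \<alpha> \<in> \<Omega> \<Longrightarrow> \<beta> \<in> \<Omega> \<Longrightarrow> [c \<alpha> = c \<beta>] (mod int p)"
begin

lemma realized_mod_constant:
  assumes "realized_mod c id" "\<alpha> \<in> \<Omega>" "\<beta> \<in> \<Omega>" shows "[c \<alpha> = c \<beta>] (mod int p)"
proof -
  obtain z where "realized (\<lambda>\<omega>. c \<omega> + z) id" using assms unfolding realized_mod_def by blast
  from kernel_constant[OF this assms(2,3)] show ?thesis by (simp add: cong_add_rcancel)
qed

lemma realized_mod_unique:
  assumes "realized_mod c g" "realized_mod d g" "\<alpha> \<in> \<Omega>" "\<beta> \<in> \<Omega>"
  shows "[c \<alpha> - d \<alpha> = c \<beta> - d \<beta>] (mod int p)"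
proof -
  have "g permutes \<Omega>" using realized_mod_permutes assms by blast
  then show ?thesis
    using realized_mod_constant[OF _ assms(3,4)] realized_mod_quotient[OF assms(1,2)] by (simp add: permutes_inverses permutes_inv_o)
qed

text \<open>
  Conjugating a lift of \<open>t\<close> by a lift of a 3-cycle \<open>u\<close> disjoint from \<open>t\<close> gives another lift of \<open>t\<close>, whose
  shift function differs by a constant. The constant vanishes, as seen at a common fixed point of \<open>t\<close> and
  \<open>u\<close>; hence points that \<open>u\<close> moves to each other are shifted equally. The seven points needed are the
  supports of \<open>t\<close> and \<open>u\<close> and the common fixed point.
\<close>

lemma constant_on_fixed_points:
  assumes c: "realized_mod c (cycle_of_list [\<alpha>, \<beta>, \<gamma>])" and d: "distinct [\<alpha>, \<beta>, \<gamma>]" "{\<alpha>, \<beta>, \<gamma>} \<subseteq> \<Omega>"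
    and w: "\<omega> \<in> \<Omega> - {\<alpha>, \<beta>, \<gamma>}" "\<omega>' \<in> \<Omega> - {\<alpha>, \<beta>, \<gamma>}"
  shows "[c \<omega> = c \<omega>'] (mod int p)"
proof (cases "\<omega> = \<omega>'")
  case False
  obtain \<mu> where m: "\<mu> \<in> \<Omega>" "\<mu> \<notin> {\<alpha>, \<beta>, \<gamma>, \<omega>, \<omega>'}"
    by (rule fresh_point[of "[\<alpha>, \<beta>, \<gamma>, \<omega>, \<omega>']"]) auto
  obtain \<nu> where n: "\<nu> \<in> \<Omega>" "\<nu> \<notin> {\<alpha>, \<beta>, \<gamma>, \<omega>, \<omega>', \<mu>}"
    by (rule fresh_point[of "[\<alpha>, \<beta>, \<gamma>, \<omega>, \<omega>', \<mu>]"]) auto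
  let ?t = "cycle_of_list [\<alpha>, \<beta>, \<gamma>]" and ?u = "cycle_of_list [\<omega>', \<omega>, \<mu>]"
  have u: "distinct [\<omega>', \<omega>, \<mu>]" "{\<omega>', \<omega>, \<mu>} \<subseteq> \<Omega>" using w m False by auto
  obtain e where e: "realized_mod e ?u" using three_cycle[OF u] realized_imp_realized_mod by blast
  have bij: "bij ?u" using realized_mod_permutes[OF e] permutes_bij by blast
  have "?u \<circ> ?t \<circ> inv' ?u = ?t"
    using conjugate_three_cycle[OF d(1) bij] u d w m by (auto simp: three_cycle_apply)
  then have "realized_mod (\<lambda>\<xi>. - e (inv' ?u \<xi>) + c (inv' ?u \<xi>) + e (?t (inv' ?u \<xi>))) ?t"
    using realized_mod_conjugate[OF e c] by simp
  from realized_mod_unique[OF this c, of \<omega> \<nu>] show ?thesis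
    using u d w m n by (auto simp: inv_three_cycle three_cycle_apply cong_iff_dvd_diff dvd_diff_commute)
qed simp

text \<open>
  Among the lifts of a 3-cycle modulo constants, the one that acts trivially over the fixed points of the
  3-cycle.
\<close>

definition normal_lift :: "('a \<Rightarrow> int) \<Rightarrow> 'a \<Rightarrow> 'a \<Rightarrow> 'a \<Rightarrow> bool" where
  "normal_lift c \<alpha> \<beta> \<gamma> \<longleftrightarrow> distinct [\<alpha>, \<beta>, \<gamma>] \<and> {\<alpha>, \<beta>, \<gamma>} \<subseteq> \<Omega> \<and>
     realized_mod c (cycle_of_list [\<alpha>, \<beta>, \<gamma>]) \<and> (\<forall>\<omega>\<in>\<Omega> - {\<alpha>, \<beta>, \<gamma>}. [c \<omega> = 0] (mod int p))"

lemma normal_lift_exists: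
  assumes "distinct [\<alpha>, \<beta>, \<gamma>]" "{\<alpha>, \<beta>, \<gamma>} \<subseteq> \<Omega>"
  shows "\<exists>c. normal_lift c \<alpha> \<beta> \<gamma>"
proof -
  obtain c where c: "realized_mod c (cycle_of_list [\<alpha>, \<beta>, \<gamma>])" using three_cycle[OF assms] realized_imp_realized_mod by blast
  obtain \<delta> where d: "\<delta> \<in> \<Omega>" "\<delta> \<notin> {\<alpha>, \<beta>, \<gamma>}" by (rule fresh_point[of "[\<alpha>, \<beta>, \<gamma>]"]) auto
  have "normal_lift (\<lambda>\<omega>. c \<omega> + - c \<delta>) \<alpha> \<beta> \<gamma>"
    unfolding normal_lift_def
  proof (intro conjI ballI assms realized_mod_shift c)
    fix \<omega> assume "\<omega> \<in> \<Omega> - {\<alpha>, \<beta>, \<gamma>}"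
    then have "[c \<omega> = c \<delta>] (mod int p)" using constant_on_fixed_points[OF c assms] d by blast
    then show "[c \<omega> + - c \<delta> = 0] (mod int p)" by (simp add: cong_iff_dvd_diff)
  qed
  then show ?thesis by blast
qed

lemma normal_lift_rotate: "normal_lift c \<alpha> \<beta> \<gamma> \<Longrightarrow> normal_lift c \<beta> \<gamma> \<alpha>"
  using cycle_of_list_rotate_independent[of "[\<alpha>, \<beta>, \<gamma>]" 1]
  by (auto simp: normal_lift_def)

lemma normal_lift_inverse:
  assumes "normal_lift c \<alpha> \<beta> \<gamma>"
  shows "normal_lift (\<lambda>\<omega>. - c (cycle_of_list [\<beta>, \<alpha>, \<gamma>] \<omega>)) \<beta> \<alpha> \<gamma>"
proof -
  have d: "distinct [\<alpha>, \<beta>, \<gamma>]" "distinct [\<beta>, \<alpha>, \<gamma>]" using assms by (auto simp: normal_lift_def)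
  have "realized_mod (\<lambda>\<omega>. - c (cycle_of_list [\<beta>, \<alpha>, \<gamma>] \<omega>)) (cycle_of_list [\<beta>, \<alpha>, \<gamma>])"
    using realized_mod_inverse[of c "cycle_of_list [\<alpha>, \<beta>, \<gamma>]"] assms d
    by (simp add: normal_lift_def inv_three_cycle)
  then show ?thesis
    using assms d by (auto simp: normal_lift_def three_cycle_apply cong_minus_minus_iff[of _ 0, simplified])
qed

lemma normal_lift_conjugate:
  assumes c: "normal_lift c \<alpha> \<beta> \<gamma>" and e: "realized_mod e g"
  shows "normal_lift (\<lambda>\<omega>. - e (inv' g \<omega>) + c (inv' g \<omega>) + e (cycle_of_list [\<alpha>, \<beta>, \<gamma>] (inv' g \<omega>)))
           (g \<alpha>) (g \<beta>) (g \<gamma>)"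
proof -
  have d: "distinct [\<alpha>, \<beta>, \<gamma>]" "{\<alpha>, \<beta>, \<gamma>} \<subseteq> \<Omega>" using assms by (auto simp: normal_lift_def)
  have g: "g permutes \<Omega>" using realized_mod_permutes[OF e] .
  have inj: "g x = g y \<longleftrightarrow> x = y" for x y using permutes_inj[OF g] by (simp add: inj_eq)
  have "distinct [g \<alpha>, g \<beta>, g \<gamma>]" "{g \<alpha>, g \<beta>, g \<gamma>} \<subseteq> \<Omega>"
    using d permutes_in_image[OF g] by (auto simp: inj)
  moreover have "realized_mod (\<lambda>\<omega>. - e (inv' g \<omega>) + c (inv' g \<omega>) + e (cycle_of_list [\<alpha>, \<beta>, \<gamma>] (inv' g \<omega>)))
      (cycle_of_list [g \<alpha>, g \<beta>, g \<gamma>])"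
    using realized_mod_conjugate[OF e, of c "cycle_of_list [\<alpha>, \<beta>, \<gamma>]"] c conjugate_three_cycle[OF d(1) permutes_bij[OF g]]
    by (simp add: normal_lift_def)
  moreover have "[- e (inv' g \<omega>) + c (inv' g \<omega>) + e (cycle_of_list [\<alpha>, \<beta>, \<gamma>] (inv' g \<omega>)) = 0] (mod int p)"
    if w: "\<omega> \<in> \<Omega> - {g \<alpha>, g \<beta>, g \<gamma>}" for \<omega>
  proof -
    have "inv' g \<omega> \<in> \<Omega>" using w permutes_in_image[OF permutes_inv[OF g]] by blast
    moreover have "inv' g \<omega> \<notin> {\<alpha>, \<beta>, \<gamma>}" using w permutes_inverses(1)[OF g] by auto
    ultimately show ?thesis
      using c d by (auto simp: normal_lift_def three_cycle_apply)
  qed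
  ultimately show ?thesis unfolding normal_lift_def by blast
qed

text \<open>
  The cube of a normalized lift lies over the identity, so its shift is constant; over a fixed point the
  shift is zero.
\<close>

lemma normal_lift_sum:
  assumes "normal_lift c \<alpha> \<beta> \<gamma>"
  shows "[c \<alpha> + c \<beta> + c \<gamma> = 0] (mod int p)"
proof -
  let ?t = "cycle_of_list [\<alpha>, \<beta>, \<gamma>]"
  have d: "distinct [\<alpha>, \<beta>, \<gamma>]" "{\<alpha>, \<beta>, \<gamma>} \<subseteq> \<Omega>" and t: "realized_mod c ?t"
    and z: "\<And>\<omega>. \<omega> \<in> \<Omega> - {\<alpha>, \<beta>, \<gamma>} \<Longrightarrow> [c \<omega> = 0] (mod int p)"
    using assms by (auto simp: normal_lift_def)
  obtain \<delta> where e: "\<delta> \<in> \<Omega>" "\<delta> \<notin> {\<alpha>, \<beta>, \<gamma>}" by (rule fresh_point[of "[\<alpha>, \<beta>, \<gamma>]"]) auto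
  have "?t \<circ> (?t \<circ> ?t) = id" using d by (auto simp: three_cycle_apply fun_eq_iff)
  then have "realized_mod (\<lambda>\<omega>. c \<omega> + c (?t \<omega>) + c (?t (?t \<omega>))) id"
    using realized_mod_compose[OF realized_mod_compose[OF t t] t] by simp
  from realized_mod_constant[OF this, of \<alpha> \<delta>]
  have "[c \<alpha> + c \<beta> + c \<gamma> = c \<delta> + c \<delta> + c \<delta>] (mod int p)"
    using d e by (auto simp: three_cycle_apply)
  moreover have "[c \<delta> = 0] (mod int p)" using z e by blast
  ultimately show ?thesis unfolding cong_iff_dvd_diff by algebra
qed

text \<open>
  For \<open>\<gamma> \<noteq> \<delta>\<close> the quotient of the two lifts is a lift of the 3-cycle \<open>(\<beta> \<gamma> \<delta>)\<close>, which fixes \<open>\<alpha>\<close> as well as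
  some point outside \<open>{\<alpha>, \<beta>, \<gamma>, \<delta>}\<close>. Over the latter the quotient does not shift, so it does not shift over
  \<open>\<alpha>\<close> either.
\<close>

lemma normal_lift_independent:
  assumes "normal_lift c \<alpha> \<beta> \<gamma>" "normal_lift c' \<alpha> \<beta> \<delta>"
  shows "[c \<alpha> = c' \<alpha>] (mod int p)"
proof (cases "\<gamma> = \<delta>")
  case True
  obtain \<epsilon> where e: "\<epsilon> \<in> \<Omega>" "\<epsilon> \<notin> {\<alpha>, \<beta>, \<gamma>}" by (rule fresh_point[of "[\<alpha>, \<beta>, \<gamma>]"]) auto
  have "[c \<alpha> - c' \<alpha> = c \<epsilon> - c' \<epsilon>] (mod int p)"
    using realized_mod_unique[of c _ c' \<alpha> \<epsilon>] assms True e by (auto simp: normal_lift_def)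
  moreover have "[c \<epsilon> = 0] (mod int p)" "[c' \<epsilon> = 0] (mod int p)"
    using assms True e by (auto simp: normal_lift_def)
  ultimately show ?thesis unfolding cong_iff_dvd_diff by algebra
next
  case False
  let ?t = "cycle_of_list [\<alpha>, \<beta>, \<gamma>]" and ?s = "cycle_of_list [\<alpha>, \<beta>, \<delta>]"
  obtain \<epsilon> where e: "\<epsilon> \<in> \<Omega>" "\<epsilon> \<notin> {\<alpha>, \<beta>, \<gamma>, \<delta>}" by (rule fresh_point[of "[\<alpha>, \<beta>, \<gamma>, \<delta>]"]) auto
  have d: "distinct [\<alpha>, \<beta>, \<gamma>]" "distinct [\<alpha>, \<beta>, \<delta>]" "distinct [\<beta>, \<alpha>, \<delta>]" "{\<alpha>, \<beta>, \<gamma>, \<delta>} \<subseteq> \<Omega>"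
    "distinct [\<beta>, \<gamma>, \<delta>]"
    using assms False by (auto simp: normal_lift_def)
  have q: "realized_mod (\<lambda>\<omega>. c \<omega> - c' (inv' ?s (?t \<omega>))) (inv' ?s \<circ> ?t)"
    using assms by (intro realized_mod_quotient) (auto simp: normal_lift_def)
  have "inv' ?s \<circ> ?t = cycle_of_list [\<beta>, \<gamma>, \<delta>]"
    using d by (auto simp: inv_three_cycle three_cycle_apply fun_eq_iff)
  then have "[c \<alpha> - c' (inv' ?s (?t \<alpha>)) = c \<epsilon> - c' (inv' ?s (?t \<epsilon>))] (mod int p)"
    using constant_on_fixed_points[of _ \<beta> \<gamma> \<delta> \<alpha> \<epsilon>] q d e by auto
  then have "[c \<alpha> - c' \<alpha> = c \<epsilon> - c' \<epsilon>] (mod int p)"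
    using d e by (simp add: inv_three_cycle three_cycle_apply)
  moreover have "[c \<epsilon> = 0] (mod int p)" "[c' \<epsilon> = 0] (mod int p)"
    using assms e by (auto simp: normal_lift_def)
  ultimately show ?thesis unfolding cong_iff_dvd_diff by algebra
qed

text \<open>
  Writing \<open>D \<alpha> \<beta>\<close> for the shift at \<open>\<alpha>\<close> of the normalized lifts of \<open>(\<alpha> \<beta> \<gamma>)\<close>, inverting such a
  lift shows that \<open>D\<close> is alternating, and its order gives \<open>D \<alpha> \<beta> + D \<beta> \<gamma> + D \<gamma> \<alpha> = 0\<close>, so \<open>D \<alpha> \<beta> = d \<beta> - d \<alpha>\<close>. Conjugating normalized
  lifts by a lift \<open>(c, g)\<close> gives \<open>D (g \<alpha>) (g \<beta>) = D \<alpha> \<beta> + c \<beta> - c \<alpha>\<close>, which is the claim.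
\<close>

lemma lifts_are_coboundaries:
  obtains d where "\<And>c g \<alpha> \<beta>. realized c g \<Longrightarrow> \<alpha> \<in> \<Omega> \<Longrightarrow> \<beta> \<in> \<Omega> \<Longrightarrow>
    [c \<beta> - c \<alpha> = (d (g \<beta>) - d \<beta>) - (d (g \<alpha>) - d \<alpha>)] (mod int p)"
proof -
  obtain \<omega>\<^sub>0 where w0: "\<omega>\<^sub>0 \<in> \<Omega>" by (rule fresh_point[of "[]"]) auto
  define D where "D \<alpha> \<beta> = (SOME z. \<exists>c \<gamma>. normal_lift c \<alpha> \<beta> \<gamma> \<and> z = c \<alpha>)" for \<alpha> \<beta>
  have D: "[c \<alpha> = D \<alpha> \<beta>] (mod int p)" if "normal_lift c \<alpha> \<beta> \<gamma>" for c \<alpha> \<beta> \<gamma>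
  proof -
    have "\<exists>z c \<gamma>. normal_lift c \<alpha> \<beta> \<gamma> \<and> z = c \<alpha>" using that by blast
    from someI_ex[OF this] obtain c' \<gamma>' where "normal_lift c' \<alpha> \<beta> \<gamma>'" "D \<alpha> \<beta> = c' \<alpha>"
      unfolding D_def by blast
    then show ?thesis using normal_lift_independent[OF that] by simp
  qed
  have third: "\<exists>c \<gamma>. normal_lift c \<alpha> \<beta> \<gamma>" if "\<alpha> \<in> \<Omega>" "\<beta> \<in> \<Omega>" "\<alpha> \<noteq> \<beta>" for \<alpha> \<beta>
  proof -
    obtain \<gamma> where "\<gamma> \<in> \<Omega>" "\<gamma> \<notin> {\<alpha>, \<beta>}" by (rule fresh_point[of "[\<alpha>, \<beta>]"]) auto
    then show ?thesis using normal_lift_exists[of \<alpha> \<beta> \<gamma>] that by auto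
  qed
  have D_sum: "[D \<alpha> \<beta> + D \<beta> \<gamma> + D \<gamma> \<alpha> = 0] (mod int p)"
    if abc: "distinct [\<alpha>, \<beta>, \<gamma>]" "{\<alpha>, \<beta>, \<gamma>} \<subseteq> \<Omega>" for \<alpha> \<beta> \<gamma>
  proof -
    obtain c where c: "normal_lift c \<alpha> \<beta> \<gamma>" using normal_lift_exists[OF abc] by blast
    note r = normal_lift_rotate[OF c]
    from D[OF c] D[OF r] D[OF normal_lift_rotate[OF r]] normal_lift_sum[OF c]
    show ?thesis unfolding cong_iff_dvd_diff by algebra
  qed
  have D_swap: "[D \<beta> \<alpha> = - D \<alpha> \<beta>] (mod int p)" if ab: "\<alpha> \<in> \<Omega>" "\<beta> \<in> \<Omega>" "\<alpha> \<noteq> \<beta>" for \<alpha> \<beta>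
  proof -
    obtain c \<gamma> where c: "normal_lift c \<alpha> \<beta> \<gamma>" using third[OF ab] by blast
    have "distinct [\<beta>, \<alpha>, \<gamma>]" using c by (auto simp: normal_lift_def)
    then have "[- c \<alpha> = D \<beta> \<alpha>] (mod int p)"
      using D[OF normal_lift_inverse[OF c]] by (simp add: three_cycle_apply)
    with D[OF c] show ?thesis unfolding cong_iff_dvd_diff by algebra
  qed
  define d where "d \<omega> = (if \<omega> = \<omega>\<^sub>0 then 0 else D \<omega>\<^sub>0 \<omega>)" for \<omega>
  have Dd: "[D \<alpha> \<beta> = d \<beta> - d \<alpha>] (mod int p)" if ab: "\<alpha> \<in> \<Omega>" "\<beta> \<in> \<Omega>" "\<alpha> \<noteq> \<beta>" for \<alpha> \<beta>
  proof (cases "\<alpha> = \<omega>\<^sub>0 \<or> \<beta> = \<omega>\<^sub>0")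
    case True
    then show ?thesis using D_swap[OF ab(2,1)] ab by (auto simp: d_def)
  next
    case False
    then have "[D \<omega>\<^sub>0 \<alpha> + D \<alpha> \<beta> + D \<beta> \<omega>\<^sub>0 = 0] (mod int p)" "[D \<beta> \<omega>\<^sub>0 = - D \<omega>\<^sub>0 \<beta>] (mod int p)"
      using ab w0 by (auto intro!: D_sum D_swap)
    then have "[D \<alpha> \<beta> = D \<omega>\<^sub>0 \<beta> - D \<omega>\<^sub>0 \<alpha>] (mod int p)" unfolding cong_iff_dvd_diff by algebra
    then show ?thesis using False by (simp add: d_def)
  qed
  show ?thesis
  proof (rule that)
    fix e g \<alpha> \<beta> assume e: "realized e g" and ab: "\<alpha> \<in> \<Omega>" "\<beta> \<in> \<Omega>"
    show "[e \<beta> - e \<alpha> = (d (g \<beta>) - d \<beta>) - (d (g \<alpha>) - d \<alpha>)] (mod int p)"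
    proof (cases "\<alpha> = \<beta>")
      case False
      have g: "g permutes \<Omega>" using permutes[OF e] .
      have gab: "g \<alpha> \<in> \<Omega>" "g \<beta> \<in> \<Omega>" "g \<alpha> \<noteq> g \<beta>"
        using ab False permutes_in_image[OF g] permutes_inj[OF g] by (auto simp: inj_eq)
      obtain c \<gamma> where c: "normal_lift c \<alpha> \<beta> \<gamma>" using third[OF ab False] by blast
      then have "distinct [\<alpha>, \<beta>, \<gamma>]" by (auto simp: normal_lift_def)
      then have "[- e \<alpha> + c \<alpha> + e \<beta> = D (g \<alpha>) (g \<beta>)] (mod int p)"
        using D[OF normal_lift_conjugate[OF c realized_imp_realized_mod[OF e]]]
        by (simp add: permutes_inverses[OF g] three_cycle_apply)
      with D[OF c] Dd[OF ab False] Dd[OF gab] show ?thesis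
        unfolding cong_iff_dvd_diff by algebra
    qed simp
  qed
qed

end

end

section \<open>Recognizing direct and semidirect products\<close>

lemma iso_image_of_same_fibres:
  fixes G (structure)
  assumes "group G" "\<phi> \<in> hom G A" "\<psi> \<in> hom G B" "\<psi> ` carrier G = carrier B"
    and fibres: "\<And>g h. g \<in> carrier G \<Longrightarrow> h \<in> carrier G \<Longrightarrow> \<phi> g = \<phi> h \<longleftrightarrow> \<psi> g = \<psi> h"
  shows "A\<lparr>carrier := \<phi> ` carrier G\<rparr> \<cong> B"
proof -
  interpret group G by fact
  define \<theta> where "\<theta> u = \<psi> (inv_into (carrier G) \<phi> u)" for u
  have \<theta>: "\<theta> (\<phi> g) = \<psi> g" if "g \<in> carrier G" for g
    unfolding \<theta>_def using that fibres
    by (metis f_inv_into_f image_eqI inv_into_into)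
  have "\<theta> \<in> iso (A\<lparr>carrier := \<phi> ` carrier G\<rparr>) B"
  proof (rule isoI)
    show "\<theta> \<in> hom (A\<lparr>carrier := \<phi> ` carrier G\<rparr>) B"
    proof (rule homI)
      fix u assume "u \<in> carrier (A\<lparr>carrier := \<phi> ` carrier G\<rparr>)"
      then show "\<theta> u \<in> carrier B" using \<theta> assms(4) by auto
    next
      fix u v assume "u \<in> carrier (A\<lparr>carrier := \<phi> ` carrier G\<rparr>)" "v \<in> carrier (A\<lparr>carrier := \<phi> ` carrier G\<rparr>)"
      then obtain g h where gh: "g \<in> carrier G" "h \<in> carrier G" and uv: "u = \<phi> g" "v = \<phi> h" by auto
      have "\<phi> g \<otimes>\<^bsub>A\<^esub> \<phi> h = \<phi> (g \<otimes> h)" using hom_mult[OF assms(2) gh] by simp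
      then show "\<theta> (u \<otimes>\<^bsub>A\<lparr>carrier := \<phi> ` carrier G\<rparr>\<^esub> v) = \<theta> u \<otimes>\<^bsub>B\<^esub> \<theta> v"
        using gh uv \<theta> hom_mult[OF assms(3) gh] by simp
    qed
    show "bij_betw \<theta> (carrier (A\<lparr>carrier := \<phi> ` carrier G\<rparr>)) (carrier B)"
      unfolding bij_betw_def
    proof
      show "inj_on \<theta> (carrier (A\<lparr>carrier := \<phi> ` carrier G\<rparr>))"
        using \<theta> fibres by (auto simp: inj_on_def)
      show "\<theta> ` carrier (A\<lparr>carrier := \<phi> ` carrier G\<rparr>) = carrier B"
        using \<theta> assms(4) by (auto simp: image_image intro!: image_eqI)
    qed
  qed
  then show ?thesis by (rule is_isoI)
qed

text \<open>
  The action is conjugation by \<open>\<sigma> s\<close>, transported along \<open>\<alpha>\<close>, and the isomorphism pairs \<open>\<rho> u\<close>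
  with the preimage under \<open>\<alpha>\<close> of \<open>u \<sigma>(\<rho> u)\<^sup>-\<^sup>1\<close>, which lies in the kernel.
\<close>

lemma split_extension_is_semidirect:
  assumes "group H" "group N" "group Q"
    and \<rho>: "\<rho> \<in> hom H Q" and \<sigma>: "\<sigma> \<in> hom Q H" and \<rho>\<sigma>: "\<And>s. s \<in> carrier Q \<Longrightarrow> \<rho> (\<sigma> s) = s"
    and \<alpha>: "\<alpha> \<in> hom N H" and inj: "inj_on \<alpha> (carrier N)" and ker: "\<alpha> ` carrier N = kernel H Q \<rho>"
  shows "is_semidirect H N Q"
proof -
  interpret H: group H by fact
  interpret N: group N by fact
  interpret Q: group Q by fact
  interpret \<rho>: group_hom H Q \<rho> by unfold_locales (rule \<rho>)
  interpret \<sigma>: group_hom Q H \<sigma> by unfold_locales (rule \<sigma>)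
  interpret \<alpha>: group_hom N H \<alpha> by unfold_locales (rule \<alpha>)
  define \<beta> where "\<beta> = inv_into (carrier N) \<alpha>"
  have \<beta>: "\<beta> u \<in> carrier N" "\<alpha> (\<beta> u) = u" if "u \<in> carrier H" "\<rho> u = \<one>\<^bsub>Q\<^esub>" for u
  proof -
    have "u \<in> \<alpha> ` carrier N" using that ker by (simp add: kernel_def)
    then show "\<beta> u \<in> carrier N" "\<alpha> (\<beta> u) = u"
      unfolding \<beta>_def by (rule inv_into_into, rule f_inv_into_f)
  qed
  have \<alpha>_ker: "\<rho> (\<alpha> m) = \<one>\<^bsub>Q\<^esub>" if "m \<in> carrier N" for m
    using that ker by (auto simp: kernel_def)
  have \<alpha>_eq: "\<alpha> m = \<alpha> m' \<longleftrightarrow> m = m'" if "m \<in> carrier N" "m' \<in> carrier N" for m m'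
    using that inj by (auto simp: inj_on_def)
  define \<theta> where "\<theta> s = (\<lambda>m\<in>carrier N. \<beta> (\<sigma> s \<otimes>\<^bsub>H\<^esub> \<alpha> m \<otimes>\<^bsub>H\<^esub> inv\<^bsub>H\<^esub> \<sigma> s))" for s
  have \<theta>: "\<theta> s m \<in> carrier N" "\<alpha> (\<theta> s m) = \<sigma> s \<otimes>\<^bsub>H\<^esub> \<alpha> m \<otimes>\<^bsub>H\<^esub> inv\<^bsub>H\<^esub> \<sigma> s"
    if "s \<in> carrier Q" "m \<in> carrier N" for s m
    using that \<beta>[of "\<sigma> s \<otimes>\<^bsub>H\<^esub> \<alpha> m \<otimes>\<^bsub>H\<^esub> inv\<^bsub>H\<^esub> \<sigma> s"] by (simp_all add: \<theta>_def \<alpha>_ker \<rho>\<sigma>)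
  have \<theta>_hom: "\<theta> s \<in> hom N N" if s: "s \<in> carrier Q" for s
  proof (rule homI)
    fix m m' assume m: "m \<in> carrier N" "m' \<in> carrier N"
    have "\<alpha> (\<theta> s (m \<otimes>\<^bsub>N\<^esub> m')) = \<alpha> (\<theta> s m \<otimes>\<^bsub>N\<^esub> \<theta> s m')"
      using s m by (simp add: \<theta> H.m_assoc H.inv_solve_left)
    then show "\<theta> s (m \<otimes>\<^bsub>N\<^esub> m') = \<theta> s m \<otimes>\<^bsub>N\<^esub> \<theta> s m'"
      by (subst (asm) \<alpha>_eq) (use s m \<theta>(1) in auto)
  qed (use s \<theta> in blast)
  have \<theta>_mult: "\<theta> (s \<otimes>\<^bsub>Q\<^esub> t) m = \<theta> s (\<theta> t m)"
    if "s \<in> carrier Q" "t \<in> carrier Q" "m \<in> carrier N" for s t m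
  proof -
    have "\<alpha> (\<theta> (s \<otimes>\<^bsub>Q\<^esub> t) m) = \<alpha> (\<theta> s (\<theta> t m))"
      using that by (simp add: \<theta> H.m_assoc H.inv_mult_group)
    then show ?thesis by (subst (asm) \<alpha>_eq) (use that \<theta>(1) in auto)
  qed
  have \<theta>_one: "\<theta> \<one>\<^bsub>Q\<^esub> m = m" if "m \<in> carrier N" for m
  proof -
    have "\<alpha> (\<theta> \<one>\<^bsub>Q\<^esub> m) = \<alpha> m" using that by (simp add: \<theta>)
    then show ?thesis by (subst (asm) \<alpha>_eq) (use that \<theta>(1) in auto)
  qed
  have \<theta>_Bij: "\<theta> s \<in> Bij (carrier N)" if s: "s \<in> carrier Q" for s
  proof -
    have "bij_betw (\<theta> s) (carrier N) (carrier N)"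
    proof (rule bij_betw_byWitness[where f' = "\<theta> (inv\<^bsub>Q\<^esub> s)"])
      show "\<forall>m\<in>carrier N. \<theta> (inv\<^bsub>Q\<^esub> s) (\<theta> s m) = m" "\<forall>m\<in>carrier N. \<theta> s (\<theta> (inv\<^bsub>Q\<^esub> s) m) = m"
        using s by (simp_all add: \<theta>_mult[symmetric] \<theta>_one)
    qed (use s \<theta> in auto)
    then show ?thesis by (simp add: Bij_def \<theta>_def)
  qed
  have "\<theta> \<in> hom Q (AutoGroup N)"
  proof (rule homI)
    fix s t assume st: "s \<in> carrier Q" "t \<in> carrier Q"
    have "compose (carrier N) (\<theta> s) (\<theta> t) = \<theta> (s \<otimes>\<^bsub>Q\<^esub> t)"
    proof
      fix m
      show "compose (carrier N) (\<theta> s) (\<theta> t) m = \<theta> (s \<otimes>\<^bsub>Q\<^esub> t) m"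
        using st by (cases "m \<in> carrier N") (simp_all add: compose_def \<theta>_mult, simp add: \<theta>_def)
    qed
    then show "\<theta> (s \<otimes>\<^bsub>Q\<^esub> t) = \<theta> s \<otimes>\<^bsub>AutoGroup N\<^esub> \<theta> t"
      using st by (simp add: AutoGroup_def BijGroup_def \<theta>_Bij)
  qed (simp add: AutoGroup_def auto_def \<theta>_hom \<theta>_Bij)
  moreover
  define \<nu> where "\<nu> u = \<beta> (u \<otimes>\<^bsub>H\<^esub> inv\<^bsub>H\<^esub> \<sigma> (\<rho> u))" for u
  have \<nu>: "\<nu> u \<in> carrier N" "\<alpha> (\<nu> u) = u \<otimes>\<^bsub>H\<^esub> inv\<^bsub>H\<^esub> \<sigma> (\<rho> u)" if "u \<in> carrier H" for u
    using that \<beta>[of "u \<otimes>\<^bsub>H\<^esub> inv\<^bsub>H\<^esub> \<sigma> (\<rho> u)"] by (simp_all add: \<nu>_def \<rho>\<sigma>)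
  have "(\<lambda>u. (\<nu> u, \<rho> u)) \<in> iso H (semidirect_product N Q \<theta>)"
  proof (rule isoI)
    show "(\<lambda>u. (\<nu> u, \<rho> u)) \<in> hom H (semidirect_product N Q \<theta>)"
    proof (rule homI)
      fix u v assume uv: "u \<in> carrier H" "v \<in> carrier H"
      have "inv\<^bsub>H\<^esub> \<sigma> (\<rho> u) \<otimes>\<^bsub>H\<^esub> (\<sigma> (\<rho> u) \<otimes>\<^bsub>H\<^esub> w) = w" if "w \<in> carrier H" for w
        using uv that by (simp add: H.m_assoc[symmetric])
      then have "\<alpha> (\<nu> (u \<otimes>\<^bsub>H\<^esub> v)) = \<alpha> (\<nu> u \<otimes>\<^bsub>N\<^esub> \<theta> (\<rho> u) (\<nu> v))"
        using uv by (simp add: \<nu> \<theta> H.m_assoc H.inv_mult_group)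
      then have "\<nu> (u \<otimes>\<^bsub>H\<^esub> v) = \<nu> u \<otimes>\<^bsub>N\<^esub> \<theta> (\<rho> u) (\<nu> v)"
        by (subst (asm) \<alpha>_eq) (use uv \<nu>(1) \<theta>(1) in auto)
      then show "(\<nu> (u \<otimes>\<^bsub>H\<^esub> v), \<rho> (u \<otimes>\<^bsub>H\<^esub> v)) = (\<nu> u, \<rho> u) \<otimes>\<^bsub>semidirect_product N Q \<theta>\<^esub> (\<nu> v, \<rho> v)"
        using uv by (simp add: semidirect_product_def)
    qed (simp add: semidirect_product_def \<nu>)
    show "bij_betw (\<lambda>u. (\<nu> u, \<rho> u)) (carrier H) (carrier (semidirect_product N Q \<theta>))"
    proof (rule bij_betw_byWitness[where f' = "\<lambda>(m, s). \<alpha> m \<otimes>\<^bsub>H\<^esub> \<sigma> s"])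
      show "\<forall>u\<in>carrier H. (case (\<nu> u, \<rho> u) of (m, s) \<Rightarrow> \<alpha> m \<otimes>\<^bsub>H\<^esub> \<sigma> s) = u"
        by (simp add: \<nu> H.m_assoc)
      have "\<nu> (\<alpha> m \<otimes>\<^bsub>H\<^esub> \<sigma> s) = m" if "m \<in> carrier N" "s \<in> carrier Q" for m s
      proof -
        have "\<alpha> (\<nu> (\<alpha> m \<otimes>\<^bsub>H\<^esub> \<sigma> s)) = \<alpha> m"
          using that by (simp add: \<nu> \<alpha>_ker \<rho>\<sigma> H.m_assoc)
        then show ?thesis by (subst (asm) \<alpha>_eq) (use that \<nu>(1) in auto)
      qed
      then show "\<forall>z\<in>carrier (semidirect_product N Q \<theta>).
          (\<lambda>u. (\<nu> u, \<rho> u)) (case z of (m, s) \<Rightarrow> \<alpha> m \<otimes>\<^bsub>H\<^esub> \<sigma> s) = z"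
        by (auto simp: semidirect_product_def \<alpha>_ker \<rho>\<sigma>)
    qed (auto simp: semidirect_product_def \<nu>)
  qed
  then have "H \<cong> semidirect_product N Q \<theta>" by (rule is_isoI)
  ultimately show ?thesis unfolding is_semidirect_def by blast
qed

text \<open>
  For \<open>g\<close> outside \<open>K\<close> the cosets \<open>gK\<close> and \<open>K\<close> fill the group; a square \<open>gg\<close> in \<open>gK\<close> would put \<open>g\<close>
  into \<open>K\<close>.
\<close>

lemma index_two_contains_squares:
  fixes G (structure)
  assumes "group G" "finite (carrier G)" "subgroup K G" "2 * card K = card (carrier G)" "g \<in> carrier G"
  shows "g \<otimes>\<^bsub>G\<^esub> g \<in> K"
proof (rule ccontr)
  interpret group G by fact
  interpret K: subgroup K G by fact
  assume sq: "g \<otimes> g \<notin> K"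
  then have g: "g \<notin> K" by auto
  let ?gK = "(\<lambda>k. g \<otimes> k) ` K"
  have "?gK \<inter> K = {}"
  proof (rule ccontr)
    assume "?gK \<inter> K \<noteq> {}"
    then obtain k where k: "k \<in> K" "g \<otimes> k \<in> K" by blast
    then have "g \<otimes> k \<otimes> inv k \<in> K" by simp
    then show False using g k assms(5) by (simp add: m_assoc)
  qed
  moreover have "card ?gK = card K"
    using assms(5) by (intro card_image) (auto simp: inj_on_def)
  moreover have fin: "finite K" using assms(2) K.subset finite_subset by blast
  ultimately have "card (?gK \<union> K) = card (carrier G)"
    using assms(4) by (simp add: card_Un_disjoint)
  then have "?gK \<union> K = carrier G"
    using assms(2,5) by (intro card_subset_eq) auto
  then have "g \<otimes> g \<in> ?gK" using sq assms(5) by blast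
  then show False using g assms(5) by (auto)
qed

text \<open>
  An instance of Goursat's lemma: a perfect group and an abelian group have no common nontrivial quotient.
  Concretely, \<open>\<kappa>\<close> maps the derived subgroup of \<open>G\<close> onto \<open>Q\<close>, and \<open>\<chi>\<close> is trivial on it, so the \<open>Q\<close>-component
  can be corrected by a factor from the derived subgroup.
\<close>

lemma hom_pair_onto:
  fixes G (structure)
  assumes "group G" "group Q" "derived Q (carrier Q) = carrier Q" "comm_group A"
    and \<kappa>: "\<kappa> \<in> hom G Q" "\<kappa> ` carrier G = carrier Q"
    and \<chi>: "\<chi> \<in> hom G A" "\<chi> ` carrier G = carrier A"
  shows "(\<lambda>g. (\<chi> g, \<kappa> g)) ` carrier G = carrier (A \<times>\<times> Q)"
proof -
  interpret group G by fact
  interpret A: comm_group A by fact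
  interpret \<kappa>: group_hom G Q \<kappa> by (simp add: group_hom_def group_hom_axioms_def assms)
  interpret \<chi>: group_hom G A \<chi> by (simp add: group_hom_def group_hom_axioms_def assms A.group_axioms)
  have pair: "\<exists>y\<in>carrier G. \<chi> y = \<chi> g \<and> \<kappa> y = \<kappa> h" if gh: "g \<in> carrier G" "h \<in> carrier G" for g h
  proof -
    have "derived Q (\<kappa> ` carrier G) = \<kappa> ` derived G (carrier G)"
      by (rule \<kappa>.derived_img) simp
    then have "\<kappa> (inv g \<otimes> h) \<in> \<kappa> ` derived G (carrier G)"
      using \<kappa>(2) assms(3) gh by auto
    then obtain z where z: "z \<in> derived G (carrier G)" and \<kappa>z: "\<kappa> (inv g \<otimes> h) = \<kappa> z" by blast
    have zG: "z \<in> carrier G" using z derived_in_carrier[of "carrier G"] by blast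
    have "\<chi> ` derived G (carrier G) = derived A (\<chi> ` carrier G)"
      by (rule \<chi>.derived_img[symmetric]) simp
    also have "\<dots> = {\<one>\<^bsub>A\<^esub>}"
      by (rule A.derived_eq_singleton) auto
    finally have "\<chi> z = \<one>\<^bsub>A\<^esub>" using z by blast
    moreover have "\<kappa> (g \<otimes> z) = \<kappa> h"
      using gh zG by (simp add: \<kappa>z[symmetric] \<kappa>.H.m_assoc[symmetric])
    ultimately show ?thesis using gh zG by (intro bexI[of _ "g \<otimes> z"]) auto
  qed
  show ?thesis
  proof
    show "(\<lambda>g. (\<chi> g, \<kappa> g)) ` carrier G \<subseteq> carrier (A \<times>\<times> Q)" by auto
    show "carrier (A \<times>\<times> Q) \<subseteq> (\<lambda>g. (\<chi> g, \<kappa> g)) ` carrier G"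
    proof
      fix v assume "v \<in> carrier (A \<times>\<times> Q)"
      then obtain a s where v: "v = (a, s)" "a \<in> \<chi> ` carrier G" "s \<in> \<kappa> ` carrier G"
        by (auto simp: \<kappa>(2) \<chi>(2))
      then obtain g h where gh: "g \<in> carrier G" "h \<in> carrier G" "a = \<chi> g" "s = \<kappa> h" by blast
      obtain y where "y \<in> carrier G" "\<chi> y = \<chi> g" "\<kappa> y = \<kappa> h" using pair[OF gh(1,2)] by blast
      then show "v \<in> (\<lambda>g. (\<chi> g, \<kappa> g)) ` carrier G" using v(1) gh by (intro image_eqI[of _ _ y]) simp_all
    qed
  qed
qed

section \<open>The wreath product acting on a cyclic cover\<close>

text \<open>
  The map \<open>F\<close> identifies \<open>\<int>/p \<times> \<Omega>\<close> with a set \<open>U\<close>; the first coordinate is represented by all integers of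
  its residue class, which keeps shifting free of reductions modulo \<open>p\<close>.
\<close>

locale cyclic_cover =
  fixes \<Omega> :: "'a set" and p :: nat and F :: "int \<Rightarrow> 'a \<Rightarrow> 'b"
  assumes F_eq_iff: "\<omega> \<in> \<Omega> \<Longrightarrow> \<omega>' \<in> \<Omega> \<Longrightarrow>
    F j \<omega> = F j' \<omega>' \<longleftrightarrow> [j = j'] (mod int p) \<and> \<omega> = \<omega>'"
begin

definition U :: "'b set" where
  "U = {F j \<omega> | j \<omega>. \<omega> \<in> \<Omega>}"

text \<open>
  The element \<open>(c, g)\<close> of the wreath product as a permutation of \<open>U\<close>. The description is unambiguous when
  \<open>g\<close> permutes \<open>\<Omega>\<close>, since the integers \<open>j\<close> labelling a point are congruent.
\<close>

definition lift :: "('a \<Rightarrow> int) \<Rightarrow> ('a \<Rightarrow> 'a) \<Rightarrow> 'b \<Rightarrow> 'b" where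
  "lift c g u = (if u \<in> U then THE v. \<exists>j \<omega>. \<omega> \<in> \<Omega> \<and> u = F j \<omega> \<and> v = F (j + c \<omega>) (g \<omega>) else u)"

lemma lift_F:
  assumes "\<omega> \<in> \<Omega>" "g permutes \<Omega>"
  shows "lift c g (F j \<omega>) = F (j + c \<omega>) (g \<omega>)"
proof -
  have "F j \<omega> \<in> U" using assms by (auto simp: U_def)
  moreover have "(THE v. \<exists>j' \<omega>'. \<omega>' \<in> \<Omega> \<and> F j \<omega> = F j' \<omega>' \<and> v = F (j' + c \<omega>') (g \<omega>')) = F (j + c \<omega>) (g \<omega>)"
    using assms permutes_in_image[OF assms(2)]
    by (intro the_equality) (auto simp: F_eq_iff cong_add_rcancel intro: cong_sym)
  ultimately show ?thesis by (simp add: lift_def)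
qed

lemma eq_lift_iff:
  assumes "g permutes \<Omega>"
  shows "u = lift c g \<longleftrightarrow> (\<forall>\<omega>\<in>\<Omega>. \<forall>j. u (F j \<omega>) = F (j + c \<omega>) (g \<omega>)) \<and> (\<forall>v. v \<notin> U \<longrightarrow> u v = v)"
    (is "_ \<longleftrightarrow> ?R")
proof
  assume "u = lift c g" then show ?R using assms by (auto simp: lift_F) (simp add: lift_def)
next
  assume R: ?R
  show "u = lift c g"
  proof
    fix v show "u v = lift c g v"
    proof (cases "v \<in> U")
      case True then show ?thesis using R assms by (auto simp: U_def lift_F)
    next
      case False then show ?thesis using R by (simp add: lift_def)
    qed
  qed
qed

lemma lift_eq_iff:
  assumes "g permutes \<Omega>" "h permutes \<Omega>"
  shows "lift c g = lift d h \<longleftrightarrow> g = h \<and> (\<forall>\<omega>\<in>\<Omega>. [c \<omega> = d \<omega>] (mod int p))"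
proof -
  have F: "F j (g \<omega>) = F j' (h \<omega>) \<longleftrightarrow> [j = j'] (mod int p) \<and> g \<omega> = h \<omega>" if "\<omega> \<in> \<Omega>" for j j' \<omega>
    using F_eq_iff[of "g \<omega>" "h \<omega>" j j'] that permutes_in_image[OF assms(1)] permutes_in_image[OF assms(2)] by blast
  show ?thesis
  proof
    assume eq: "lift c g = lift d h"
    have *: "[c \<omega> = d \<omega>] (mod int p) \<and> g \<omega> = h \<omega>" if w: "\<omega> \<in> \<Omega>" for \<omega>
      using F[OF w, of "0 + c \<omega>" "0 + d \<omega>"] lift_F[OF w assms(1), of c 0] lift_F[OF w assms(2), of d 0] eq by simp
    then have "g = h"
      using assms by (metis ext permutes_not_in)
    with * show "g = h \<and> (\<forall>\<omega>\<in>\<Omega>. [c \<omega> = d \<omega>] (mod int p))" by blast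
  next
    assume eq: "g = h \<and> (\<forall>\<omega>\<in>\<Omega>. [c \<omega> = d \<omega>] (mod int p))"
    show "lift c g = lift d h"
      by (rule eq_lift_iff[OF assms(2), THEN iffD2])
        (use eq assms(2) F in \<open>auto simp: lift_F cong_add_lcancel\<close>, simp add: lift_def)
  qed
qed

lemma lift_id: "lift (\<lambda>_. 0) id = id"
  by (rule eq_lift_iff[THEN iffD2, symmetric]) (auto simp: permutes_id)

lemma lift_compose:
  assumes "g permutes \<Omega>" "h permutes \<Omega>"
  shows "lift d h \<circ> lift c g = lift (\<lambda>\<omega>. c \<omega> + d (g \<omega>)) (h \<circ> g)"
  using assms permutes_in_image[OF assms(1)]
  by (subst eq_lift_iff) (auto simp: permutes_compose lift_F add.assoc, simp add: lift_def)

lemma lift_permutes: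
  assumes "g permutes \<Omega>" shows "lift c g permutes U"
proof -
  have g: "inv' g permutes \<Omega>" using assms by (rule permutes_inv)
  have "lift (\<lambda>\<omega>. - c (inv' g \<omega>)) (inv' g) \<circ> lift c g = id" "lift c g \<circ> lift (\<lambda>\<omega>. - c (inv' g \<omega>)) (inv' g) = id"
    using assms g by (simp_all add: lift_compose permutes_inverses permutes_inv_o lift_id)
  then have "bij (lift c g)" using o_bij by blast
  then show ?thesis by (auto simp: permutes_def bij_iff lift_def)
qed

lemma lift_inverse:
  assumes "g permutes \<Omega>"
  shows "inv' (lift c g) = lift (\<lambda>\<omega>. - c (inv' g \<omega>)) (inv' g)"
  using assms permutes_inv[OF assms]
  by (intro inv_unique_comp) (simp_all add: lift_compose permutes_inverses permutes_inv_o lift_id)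

end

lemma group_image_group:
  assumes "group G" "\<pi> \<in> hom G (Sym S)"
  shows "group (image_group G S \<pi>)"
proof -
  interpret group_hom G "Sym S" \<pi>
    using assms group_Sym by (simp add: group_hom_def group_hom_axioms_def)
  show ?thesis
    unfolding image_group_def using H.subgroup_imp_group[OF img_is_subgroup] .
qed

lemma inv_Sym: "g permutes S \<Longrightarrow> inv\<^bsub>Sym S\<^esub> g = inv' g"
  by (rule group.inv_equality[OF group_Sym]) (simp_all add: Sym_def permutes_inv_o permutes_inv)

text \<open>
  A group \<open>G\<close> acting on the cover by sum-zero lifts of its action on \<open>\<Omega>\<close>, where the latter contains all
  3-cycles. The isomorphism \<open>\<iota>\<close> lets the results be stated for an abstract copy \<open>Q\<close> of the permutation group
  \<open>\<pi>(G)\<close>.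
\<close>

locale zero_sum_cover = cyclic_cover \<Omega> p F + G: group G
  for \<Omega> :: "'a set" and p and F :: "int \<Rightarrow> 'a \<Rightarrow> 'b" and G :: "('g, 'm) monoid_scheme" (structure) +
  fixes \<pi> :: "'g \<Rightarrow> 'a \<Rightarrow> 'a" and \<phi> :: "'g \<Rightarrow> 'b \<Rightarrow> 'b"
    and Q :: "('q, 'k) monoid_scheme" and \<iota> :: "('a \<Rightarrow> 'a) \<Rightarrow> 'q"
  assumes prime: "prime p" and finite: "finite \<Omega>" and card_gt: "card \<Omega> > 6"
    and \<pi>: "\<pi> \<in> hom G (Sym \<Omega>)" and \<phi>: "\<phi> \<in> hom G (Sym U)"
    and three_cycle: "distinct [\<alpha>, \<beta>, \<gamma>] \<Longrightarrow> {\<alpha>, \<beta>, \<gamma>} \<subseteq> \<Omega> \<Longrightarrow>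
      cycle_of_list [\<alpha>, \<beta>, \<gamma>] \<in> \<pi> ` carrier G"
    and \<phi>_lift: "g \<in> carrier G \<Longrightarrow> \<exists>c. [(\<Sum>\<omega>\<in>\<Omega>. c \<omega>) = 0] (mod int p) \<and> \<phi> g = lift c (\<pi> g)"
    and Q: "group Q" and \<iota>: "\<iota> \<in> iso (image_group G \<Omega> \<pi>) Q"
begin

definition realized :: "('a \<Rightarrow> int) \<Rightarrow> ('a \<Rightarrow> 'a) \<Rightarrow> bool" where
  "realized c g \<longleftrightarrow> g permutes \<Omega> \<and> lift c g \<in> \<phi> ` carrier G"

sublocale \<pi>: group_hom G "Sym \<Omega>" \<pi>
  using \<pi> group_Sym by (simp add: group_hom_def group_hom_axioms_def)

sublocale \<phi>: group_hom G "Sym U" \<phi>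
  using \<phi> group_Sym by (simp add: group_hom_def group_hom_axioms_def)

lemma \<pi>_permutes: "g \<in> carrier G \<Longrightarrow> \<pi> g permutes \<Omega>"
  using \<pi>.hom_closed by (simp add: Sym_def)

lemma \<pi>_mult: "g \<in> carrier G \<Longrightarrow> h \<in> carrier G \<Longrightarrow> \<pi> (g \<otimes> h) = \<pi> h \<circ> \<pi> g"
  using \<pi>.hom_mult by (simp add: Sym_def)

lemma \<phi>_mult: "g \<in> carrier G \<Longrightarrow> h \<in> carrier G \<Longrightarrow> \<phi> (g \<otimes> h) = \<phi> h \<circ> \<phi> g"
  using \<phi>.hom_mult by (simp add: Sym_def)

lemma realized_cases:
  assumes "realized c g"
  obtains h where "h \<in> carrier G" "\<pi> h = g" "\<phi> h = lift c g"
proof -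
  obtain h where h: "h \<in> carrier G" "\<phi> h = lift c g" using assms unfolding realized_def by auto
  obtain c' where "\<phi> h = lift c' (\<pi> h)" using \<phi>_lift h by blast
  then have "\<pi> h = g" using h assms \<pi>_permutes by (auto simp: realized_def lift_eq_iff)
  then show ?thesis using that h by blast
qed

lemma realized_sum: assumes "realized c g" shows "[(\<Sum>\<omega>\<in>\<Omega>. c \<omega>) = 0] (mod int p)"
proof -
  obtain h where h: "h \<in> carrier G" "\<pi> h = g" "\<phi> h = lift c g" using realized_cases[OF assms] .
  obtain c' where c': "[(\<Sum>\<omega>\<in>\<Omega>. c' \<omega>) = 0] (mod int p)" "\<phi> h = lift c' (\<pi> h)" using \<phi>_lift h by blast
  then have "\<forall>\<omega>\<in>\<Omega>. [c \<omega> = c' \<omega>] (mod int p)"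
    using h assms by (auto simp: realized_def lift_eq_iff)
  then have "[(\<Sum>\<omega>\<in>\<Omega>. c \<omega>) = (\<Sum>\<omega>\<in>\<Omega>. c' \<omega>)] (mod int p)" by (intro cong_sum) auto
  then show ?thesis using c'(1) cong_trans by blast
qed

sublocale twisted_lifts \<Omega> p realized
proof
  show "finite \<Omega>" by (rule finite)
  show "6 < card \<Omega>" by (rule card_gt)
  show "realized c g \<Longrightarrow> g permutes \<Omega>" for c g by (simp add: realized_def)
  show "realized c' g" if "realized c g" "\<And>\<omega>. \<omega> \<in> \<Omega> \<Longrightarrow> [c \<omega> = c' \<omega>] (mod int p)" for c g c'
  proof -
    have "lift c g = lift c' g" using that by (auto simp: realized_def lift_eq_iff)
    then show ?thesis using that(1) by (simp add: realized_def)
  qed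
  show "realized (\<lambda>\<omega>. c \<omega> + d (g \<omega>)) (h \<circ> g)" if cd: "realized c g" "realized d h" for c g d h
  proof -
    obtain g' h' where "g' \<in> carrier G" "\<phi> g' = lift c g" "h' \<in> carrier G" "\<phi> h' = lift d h"
      using cd by (auto simp: realized_def)
    then have "\<phi> (g' \<otimes> h') = lift d h \<circ> lift c g" "g' \<otimes> h' \<in> carrier G" by (simp_all add: Sym_def)
    then have "lift d h \<circ> lift c g \<in> \<phi> ` carrier G" by (metis imageI)
    then show ?thesis using cd by (simp add: realized_def lift_compose permutes_compose)
  qed
  show "realized (\<lambda>\<omega>. - c (inv' g \<omega>)) (inv' g)" if c: "realized c g" for c g
  proof -
    obtain g' where g': "g' \<in> carrier G" "\<phi> g' = lift c g" using c by (auto simp: realized_def)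
    then have "\<phi> (inv g') = inv' (lift c g)"
      using c by (simp add: inv_Sym lift_permutes realized_def)
    then have "inv' (lift c g) \<in> \<phi> ` carrier G" using g' by (metis G.inv_closed imageI)
    then show ?thesis
      using c by (simp add: realized_def lift_inverse permutes_inv)
  qed
  show "\<exists>c. realized c (cycle_of_list [\<alpha>, \<beta>, \<gamma>])"
    if t: "distinct [\<alpha>, \<beta>, \<gamma>]" "{\<alpha>, \<beta>, \<gamma>} \<subseteq> \<Omega>" for \<alpha> \<beta> \<gamma>
  proof -
    obtain g where g: "g \<in> carrier G" "\<pi> g = cycle_of_list [\<alpha>, \<beta>, \<gamma>]"
      using three_cycle[OF t] by auto
    obtain c where "\<phi> g = lift c (\<pi> g)" using \<phi>_lift g(1) by blast
    then have "realized c (\<pi> g)" using \<pi>_permutes[OF g(1)] g(1) unfolding realized_def by (metis imageI)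
    then show ?thesis using g by auto
  qed
qed

lemma realized_exists: "g \<in> carrier G \<Longrightarrow> \<exists>c. \<phi> g = lift c (\<pi> g) \<and> realized c (\<pi> g)"
  using \<phi>_lift[of g] \<pi>_permutes unfolding realized_def by (metis imageI)

lemma \<iota>\<pi>_hom: "(\<lambda>g. \<iota> (\<pi> g)) \<in> hom G Q"
  using \<iota> \<pi> by (auto simp: iso_def hom_def image_group_def Pi_iff)

lemma \<iota>\<pi>_onto: "(\<lambda>g. \<iota> (\<pi> g)) ` carrier G = carrier Q"
  using \<iota> by (auto simp: iso_def image_group_def bij_betw_def image_image)

lemma \<iota>_eq_iff: "g \<in> carrier G \<Longrightarrow> h \<in> carrier G \<Longrightarrow> \<iota> (\<pi> g) = \<iota> (\<pi> h) \<longleftrightarrow> \<pi> g = \<pi> h"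
  using \<iota> by (auto simp: iso_def image_group_def bij_betw_def inj_on_def)

end

section \<open>The two possible images\<close>

context zero_sum_cover
begin

lemma carrier_image: "carrier (image_group G U \<phi>) = \<phi> ` carrier G"
  by (simp add: image_group_def)

lemma mult_image: "u \<otimes>\<^bsub>image_group G U \<phi>\<^esub> v = v \<circ> u"
  by (simp add: image_group_def Sym_def)

text \<open>
  When the kernel contains all sum-zero shifts, every sum-zero lift of an element of \<open>\<pi>(G)\<close> is realized. The
  projection to \<open>\<pi>(G)\<close> is therefore split by the lifts without shift. A sum-zero function is determined by
  its values off one point \<open>\<omega>\<^sub>0\<close>, which identifies the kernel with a power of \<open>C\<^sub>p\<close>.
\<close>

lemma full_kernel_semidirect:
  assumes full: "\<And>d. [(\<Sum>\<omega>\<in>\<Omega>. d \<omega>) = 0] (mod int p) \<Longrightarrow> realized d id"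
  shows "is_semidirect (image_group G U \<phi>) (product_group {..<card \<Omega> - 1} (\<lambda>_. integer_mod_group p)) Q"
proof -
  let ?H = "image_group G U \<phi>" and ?N = "product_group {..<card \<Omega> - 1} (\<lambda>_. integer_mod_group p)"
  let ?P = "image_group G \<Omega> \<pi>"
  have p0: "p > 0" using prime prime_gt_0_nat by blast
  have full_realized: "realized c (\<pi> g)" if g: "g \<in> carrier G" and sum: "[(\<Sum>\<omega>\<in>\<Omega>. c \<omega>) = 0] (mod int p)" for c g
  proof -
    obtain c0 where c0: "realized c0 (\<pi> g)" using realized_exists g by blast
    \<comment> \<open>The lift c differs from the realized lift c0 by a sum-zero function, which lies in the kernel.\<close>
    have "realized (\<lambda>\<omega>. c \<omega> - c0 \<omega>) id"
      using cong_diff[OF sum realized_sum[OF c0]] by (intro full) (simp add: sum_subtractf)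
    from compose[OF this c0] show ?thesis by simp
  qed
  obtain \<omega>\<^sub>0 where w0: "\<omega>\<^sub>0 \<in> \<Omega>" by (rule fresh_point[of "[]"]) auto
  obtain e where e: "bij_betw e (\<Omega> - {\<omega>\<^sub>0}) {..<card \<Omega> - 1}"
    using ex_bij_betw_finite_nat[of "\<Omega> - {\<omega>\<^sub>0}"] finite w0 by (auto simp: atLeast0LessThan)
  define ext where "ext v \<omega> = (if \<omega> = \<omega>\<^sub>0 then - (\<Sum>j<card \<Omega> - 1. v j) else v (e \<omega>))"
    for v :: "nat \<Rightarrow> int" and \<omega>
  have ext_sum: "(\<Sum>\<omega>\<in>\<Omega>. ext v \<omega>) = 0" for v
  proof -
    have "(\<Sum>\<omega>\<in>\<Omega> - {\<omega>\<^sub>0}. ext v \<omega>) = (\<Sum>\<omega>\<in>\<Omega> - {\<omega>\<^sub>0}. v (e \<omega>))"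
      by (intro sum.cong) (auto simp: ext_def)
    also have "\<dots> = (\<Sum>j<card \<Omega> - 1. v j)" by (rule sum.reindex_bij_betw[OF e])
    finally show ?thesis using finite w0 by (simp add: sum.remove[of \<Omega> \<omega>\<^sub>0] ext_def)
  qed
  have ext_inj: "(\<forall>\<omega>\<in>\<Omega>. [ext v \<omega> = ext w \<omega>] (mod int p)) \<longleftrightarrow> (\<forall>j<card \<Omega> - 1. [v j = w j] (mod int p))" for v w
  proof
    assume L: "\<forall>\<omega>\<in>\<Omega>. [ext v \<omega> = ext w \<omega>] (mod int p)"
    show "\<forall>j<card \<Omega> - 1. [v j = w j] (mod int p)"
    proof (intro allI impI)
      fix j assume "j < card \<Omega> - 1"
      then obtain \<omega> where "\<omega> \<in> \<Omega> - {\<omega>\<^sub>0}" "j = e \<omega>" using e by (auto simp: bij_betw_def)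
      then show "[v j = w j] (mod int p)" using L by (auto simp: ext_def)
    qed
  next
    assume R: "\<forall>j<card \<Omega> - 1. [v j = w j] (mod int p)"
    then have "[(\<Sum>j<card \<Omega> - 1. v j) = (\<Sum>j<card \<Omega> - 1. w j)] (mod int p)" by (intro cong_sum) auto
    moreover have "[v (e \<omega>) = w (e \<omega>)] (mod int p)" if "\<omega> \<in> \<Omega> - {\<omega>\<^sub>0}" for \<omega>
      using R bij_betwE[OF e] that by blast
    ultimately show "\<forall>\<omega>\<in>\<Omega>. [ext v \<omega> = ext w \<omega>] (mod int p)"
      by (auto simp: ext_def cong_minus_minus_iff)
  qed
  have ext_add: "ext v \<omega> + ext w \<omega> = ext (\<lambda>j. v j + w j) \<omega>" for v w \<omega>
    by (simp add: ext_def sum.distrib)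
  \<comment> \<open>The permutation of \<Omega> below an element of the image.\<close>
  define base where "base u = (THE g. g permutes \<Omega> \<and> (\<exists>c. u = lift c g))" for u
  have base: "base (lift c g) = g" if "g permutes \<Omega>" for c g
    unfolding base_def using that by (intro the_equality) (auto simp: lift_eq_iff intro: exI[of _ c])
  have base_\<phi>: "base (\<phi> g) = \<pi> g" if g: "g \<in> carrier G" for g
    using realized_exists[OF g] base[OF \<pi>_permutes[OF g]] by metis
  define \<rho> where "\<rho> u = \<iota> (base u)" for u
  have \<rho>_\<phi>: "\<rho> (\<phi> g) = \<iota> (\<pi> g)" if "g \<in> carrier G" for g
    using that by (simp add: \<rho>_def base_\<phi>)
  have \<rho>: "\<rho> \<in> hom ?H Q"
  proof (rule homI)
    fix u assume "u \<in> carrier ?H"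
    then show "\<rho> u \<in> carrier Q" using \<rho>_\<phi> hom_in_carrier[OF \<iota>\<pi>_hom] by (auto simp: carrier_image)
  next
    fix u v assume "u \<in> carrier ?H" "v \<in> carrier ?H"
    then obtain g h where gh: "g \<in> carrier G" "h \<in> carrier G" and uv: "u = \<phi> g" "v = \<phi> h"
      by (auto simp: carrier_image)
    then have "u \<otimes>\<^bsub>?H\<^esub> v = \<phi> (g \<otimes> h)" by (simp only: mult_image \<phi>_mult)
    then show "\<rho> (u \<otimes>\<^bsub>?H\<^esub> v) = \<rho> u \<otimes>\<^bsub>Q\<^esub> \<rho> v"
      using gh uv hom_mult[OF \<iota>\<pi>_hom gh] \<rho>_\<phi>[of "g \<otimes> h"] by (simp add: \<rho>_\<phi>)
  qed
  define \<kappa> where "\<kappa> = inv_into (carrier ?P) \<iota>"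
  have \<kappa>: "\<kappa> \<in> hom Q ?P" "\<And>s. s \<in> carrier Q \<Longrightarrow> \<iota> (\<kappa> s) = s"
  proof -
    have "group ?P" using group_image_group[OF G.group_axioms \<pi>] .
    then have "\<kappa> \<in> iso Q ?P" using group.iso_set_sym \<iota> unfolding \<kappa>_def by blast
    then show "\<kappa> \<in> hom Q ?P" by (simp add: iso_def)
    fix s assume "s \<in> carrier Q"
    then have "s \<in> \<iota> ` carrier ?P" using \<iota> by (simp add: iso_def bij_betw_def)
    then show "\<iota> (\<kappa> s) = s" unfolding \<kappa>_def by (rule f_inv_into_f)
  qed
  have \<kappa>_ex: "\<exists>g\<in>carrier G. \<kappa> s = \<pi> g" if "s \<in> carrier Q" for s
    using hom_in_carrier[OF \<kappa>(1) that] by (auto simp: image_group_def)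
  have \<kappa>_permutes: "\<kappa> s permutes \<Omega>" if "s \<in> carrier Q" for s
    using \<kappa>_ex[OF that] \<pi>_permutes by auto
  define \<sigma> where "\<sigma> s = lift (\<lambda>_. 0) (\<kappa> s)" for s
  have \<sigma>: "\<sigma> \<in> hom Q ?H"
  proof (rule homI)
    fix s assume "s \<in> carrier Q"
    then have "realized (\<lambda>_. 0) (\<kappa> s)" using \<kappa>_ex full_realized[of _ "\<lambda>_. 0"] by fastforce
    then show "\<sigma> s \<in> carrier ?H" by (simp add: realized_def \<sigma>_def carrier_image)
  next
    fix s t assume st: "s \<in> carrier Q" "t \<in> carrier Q"
    have "\<kappa> (s \<otimes>\<^bsub>Q\<^esub> t) = \<kappa> t \<circ> \<kappa> s"
      using hom_mult[OF \<kappa>(1) st] by (simp add: image_group_def Sym_def)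
    then show "\<sigma> (s \<otimes>\<^bsub>Q\<^esub> t) = \<sigma> s \<otimes>\<^bsub>?H\<^esub> \<sigma> t"
      using st by (simp add: \<sigma>_def mult_image lift_compose \<kappa>_permutes)
  qed
  have \<rho>\<sigma>: "\<rho> (\<sigma> s) = s" if "s \<in> carrier Q" for s
    using that by (simp add: \<rho>_def \<sigma>_def base \<kappa>_permutes \<kappa>)
  define \<alpha> where "\<alpha> v = lift (ext v) id" for v
  have \<alpha>_eq: "\<alpha> v = lift c id \<longleftrightarrow> (\<forall>\<omega>\<in>\<Omega>. [ext v \<omega> = c \<omega>] (mod int p))" for v c
    by (simp add: \<alpha>_def lift_eq_iff permutes_id)
  have carrier_N: "carrier ?N = {..<card \<Omega> - 1} \<rightarrow>\<^sub>E {0..<int p}"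
    using p0 by (simp add: carrier_integer_mod_group)
  have \<alpha>: "\<alpha> \<in> hom ?N ?H"
  proof (rule homI)
    fix v
    have "realized (ext v) id" using ext_sum by (intro full) simp
    then show "\<alpha> v \<in> carrier ?H" by (simp add: realized_def \<alpha>_def carrier_image)
  next
    fix v w
    have "\<alpha> v \<otimes>\<^bsub>?H\<^esub> \<alpha> w = lift (ext (\<lambda>j. v j + w j)) id"
      by (simp add: \<alpha>_def mult_image lift_compose permutes_id ext_add)
    also have "\<dots> = \<alpha> (v \<otimes>\<^bsub>?N\<^esub> w)"
      by (rule \<alpha>_eq[THEN iffD2, symmetric]) (simp add: ext_inj del: One_nat_def)
    finally show "\<alpha> (v \<otimes>\<^bsub>?N\<^esub> w) = \<alpha> v \<otimes>\<^bsub>?H\<^esub> \<alpha> w" ..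
  qed
  have inj: "inj_on \<alpha> (carrier ?N)"
  proof (rule inj_onI)
    fix v w assume vw: "v \<in> carrier ?N" "w \<in> carrier ?N" and "\<alpha> v = \<alpha> w"
    then have "\<forall>j<card \<Omega> - 1. [v j = w j] (mod int p)"
      using \<alpha>_eq[of v "ext w"] ext_inj by (simp add: \<alpha>_def)
    with vw show "v = w"
      unfolding carrier_N by (intro PiE_ext[of v _ _ w]) (auto simp: cong_def PiE_iff)
  qed
  have one_Q: "\<iota> g = \<one>\<^bsub>Q\<^esub> \<longleftrightarrow> g = id" if "g \<in> \<pi> ` carrier G" for g
  proof -
    have "\<iota> (\<pi> \<one>) = \<one>\<^bsub>Q\<^esub>" using hom_one[OF \<iota>\<pi>_hom G.group_axioms Q] .
    moreover have "\<pi> \<one> = id" using \<pi>.hom_one by (simp add: Sym_def)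
    ultimately show ?thesis using that \<iota>_eq_iff[OF _ G.one_closed] by force
  qed
  have ker: "\<alpha> ` carrier ?N = kernel ?H Q \<rho>"
  proof
    show "\<alpha> ` carrier ?N \<subseteq> kernel ?H Q \<rho>"
    proof
      fix u assume "u \<in> \<alpha> ` carrier ?N"
      then obtain v where v: "v \<in> carrier ?N" "u = \<alpha> v" by blast
      have "\<pi> \<one> = id" using \<pi>.hom_one by (simp add: Sym_def)
      then have "id \<in> \<pi> ` carrier G" by (metis G.one_closed imageI)
      then show "u \<in> kernel ?H Q \<rho>"
        using hom_in_carrier[OF \<alpha> v(1)] v(2) one_Q by (simp add: kernel_def \<rho>_def \<alpha>_def base permutes_id)
    qed
    show "kernel ?H Q \<rho> \<subseteq> \<alpha> ` carrier ?N"
    proof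
      fix u assume "u \<in> kernel ?H Q \<rho>"
      then obtain g where g: "g \<in> carrier G" "u = \<phi> g" and "\<rho> u = \<one>\<^bsub>Q\<^esub>"
        by (auto simp: kernel_def carrier_image)
      then have "\<pi> g = id" using \<rho>_\<phi> one_Q by auto
      then obtain c where c: "u = lift c id" "[(\<Sum>\<omega>\<in>\<Omega>. c \<omega>) = 0] (mod int p)"
        using \<phi>_lift[OF g(1)] g(2) by auto
      define v where "v = (\<lambda>j\<in>{..<card \<Omega> - 1}. c (inv_into (\<Omega> - {\<omega>\<^sub>0}) e j) mod int p)"
      have v: "v \<in> carrier ?N" using p0 unfolding carrier_N v_def by auto
      have off: "[ext v \<omega> = c \<omega>] (mod int p)" if w: "\<omega> \<in> \<Omega> - {\<omega>\<^sub>0}" for \<omega>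
        using w bij_betwE[OF e] bij_betw_inv_into_left[OF e w] by (auto simp: ext_def v_def)
      have "[(\<Sum>\<omega>\<in>\<Omega> - {\<omega>\<^sub>0}. ext v \<omega>) = (\<Sum>\<omega>\<in>\<Omega> - {\<omega>\<^sub>0}. c \<omega>)] (mod int p)"
        using off by (intro cong_sum)
      moreover have "(\<Sum>\<omega>\<in>\<Omega>. ext v \<omega>) = ext v \<omega>\<^sub>0 + (\<Sum>\<omega>\<in>\<Omega> - {\<omega>\<^sub>0}. ext v \<omega>)"
        "(\<Sum>\<omega>\<in>\<Omega>. c \<omega>) = c \<omega>\<^sub>0 + (\<Sum>\<omega>\<in>\<Omega> - {\<omega>\<^sub>0}. c \<omega>)"
        using finite w0 by (simp_all add: sum.remove)
      ultimately have "[ext v \<omega>\<^sub>0 = c \<omega>\<^sub>0] (mod int p)"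
        using ext_sum[of v] c(2) unfolding cong_iff_dvd_diff by algebra
      with off have "u = \<alpha> v" using \<alpha>_eq[of v c] c(1) by auto
      then show "u \<in> \<alpha> ` carrier ?N" using v by blast
    qed
  qed
  show ?thesis
    using group_image_group[OF G.group_axioms \<phi>] Q \<rho> \<sigma> \<rho>\<sigma> \<alpha> inj ker
    by (intro split_extension_is_semidirect[of _ _ _ \<rho> \<sigma> \<alpha>]) simp_all
qed

text \<open>
  The shift of \<open>\<phi> g\<close> minus the coboundary of \<open>d\<close> does not depend on the point, and this constant is additive in
  \<open>g\<close> by the cocycle rule.
\<close>

lemma small_kernel_character:
  assumes "\<And>c \<alpha> \<beta>. realized c id \<Longrightarrow> \<alpha> \<in> \<Omega> \<Longrightarrow> \<beta> \<in> \<Omega> \<Longrightarrow> [c \<alpha> = c \<beta>] (mod int p)"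
  obtains \<chi> d where "\<chi> \<in> hom G (integer_mod_group p)"
    and "\<And>g c \<omega>. g \<in> carrier G \<Longrightarrow> \<phi> g = lift c (\<pi> g) \<Longrightarrow> \<omega> \<in> \<Omega> \<Longrightarrow>
      [c \<omega> = d (\<pi> g \<omega>) - d \<omega> + \<chi> g] (mod int p)"
proof -
  have p0: "p > 0" using prime prime_gt_0_nat by blast
  obtain d where d: "\<And>c g \<alpha> \<beta>. realized c g \<Longrightarrow> \<alpha> \<in> \<Omega> \<Longrightarrow> \<beta> \<in> \<Omega> \<Longrightarrow>
    [c \<beta> - c \<alpha> = (d (g \<beta>) - d \<beta>) - (d (g \<alpha>) - d \<alpha>)] (mod int p)"
    using lifts_are_coboundaries[OF assms] by blast
  obtain \<omega>\<^sub>0 where w0: "\<omega>\<^sub>0 \<in> \<Omega>" by (rule fresh_point[of "[]"]) auto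
  define C where "C g = (SOME c. \<phi> g = lift c (\<pi> g))" for g
  have C: "\<phi> g = lift (C g) (\<pi> g)" if "g \<in> carrier G" for g
    using someI_ex[of "\<lambda>c. \<phi> g = lift c (\<pi> g)"] \<phi>_lift[OF that] unfolding C_def by blast
  have realized_C: "realized (C g) (\<pi> g)" if "g \<in> carrier G" for g
    using that \<pi>_permutes C[OF that] unfolding realized_def by (metis imageI)
  have C_unique: "[c \<omega> = C g \<omega>] (mod int p)" if "g \<in> carrier G" "\<phi> g = lift c (\<pi> g)" "\<omega> \<in> \<Omega>" for g c \<omega>
    using that C[OF that(1)] lift_eq_iff \<pi>_permutes by metis
  define \<chi> where "\<chi> g = (C g \<omega>\<^sub>0 - (d (\<pi> g \<omega>\<^sub>0) - d \<omega>\<^sub>0)) mod int p" for g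
  have \<chi>: "[C g \<omega> = d (\<pi> g \<omega>) - d \<omega> + \<chi> g] (mod int p)" if g: "g \<in> carrier G" and w: "\<omega> \<in> \<Omega>" for g \<omega>
  proof -
    have "[C g \<omega> - C g \<omega>\<^sub>0 = (d (\<pi> g \<omega>) - d \<omega>) - (d (\<pi> g \<omega>\<^sub>0) - d \<omega>\<^sub>0)] (mod int p)"
      by (rule d[OF realized_C[OF g] w0 w])
    moreover have "[\<chi> g = C g \<omega>\<^sub>0 - (d (\<pi> g \<omega>\<^sub>0) - d \<omega>\<^sub>0)] (mod int p)" by (simp add: \<chi>_def)
    ultimately show ?thesis unfolding cong_iff_dvd_diff by algebra
  qed
  have "\<chi> \<in> hom G (integer_mod_group p)"
  proof (rule homI)
    show "\<chi> g \<in> carrier (integer_mod_group p)" for g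
      using p0 by (simp add: \<chi>_def carrier_integer_mod_group)
    fix g h assume gh: "g \<in> carrier G" "h \<in> carrier G"
    have "\<phi> (g \<otimes> h) = lift (C h) (\<pi> h) \<circ> lift (C g) (\<pi> g)"
      using \<phi>_mult[OF gh] C gh by simp
    also have "\<dots> = lift (\<lambda>\<omega>. C g \<omega> + C h (\<pi> g \<omega>)) (\<pi> (g \<otimes> h))"
      using gh by (simp add: lift_compose \<pi>_permutes \<pi>_mult del: \<pi>.hom_mult)
    finally have "[C g \<omega>\<^sub>0 + C h (\<pi> g \<omega>\<^sub>0) = C (g \<otimes> h) \<omega>\<^sub>0] (mod int p)"
      using gh w0 by (intro C_unique) auto
    moreover have "\<pi> g \<omega>\<^sub>0 \<in> \<Omega>" using w0 permutes_in_image[OF \<pi>_permutes[OF gh(1)]] by simp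
    note \<chi>[OF gh(1) w0] \<chi>[OF gh(2) this]
    moreover have "[C (g \<otimes> h) \<omega>\<^sub>0 = d (\<pi> h (\<pi> g \<omega>\<^sub>0)) - d \<omega>\<^sub>0 + \<chi> (g \<otimes> h)] (mod int p)"
      using \<chi>[of "g \<otimes> h" \<omega>\<^sub>0] gh w0 by (simp add: Sym_def)
    ultimately have "[\<chi> (g \<otimes> h) = \<chi> g + \<chi> h] (mod int p)"
      unfolding cong_iff_dvd_diff by algebra
    then show "\<chi> (g \<otimes> h) = \<chi> g \<otimes>\<^bsub>integer_mod_group p\<^esub> \<chi> h"
      by (simp add: \<chi>_def cong_def)
  qed
  then show ?thesis
    using that[of \<chi> d] \<chi> C_unique cong_trans by blast
qed

text \<open>
  The values \<open>\<chi> g\<close> and \<open>\<pi> g\<close> determine \<open>\<phi> g\<close> and are determined by it, and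
  every pair of values occurs because \<open>Q\<close> is perfect. An element of the kernel of \<open>\<pi>\<close> with
  the nonzero character value \<open>\<chi> x\<close> has a constant shift, and the sum of this shift over \<open>\<Omega>\<close> vanishes
  modulo \<open>p\<close>, so \<open>p\<close> divides the number of points.
\<close>

lemma nontrivial_character_direct_product:
  assumes Q_perfect: "derived Q (carrier Q) = carrier Q"
    and \<chi>: "\<chi> \<in> hom G (integer_mod_group p)"
    and d: "\<And>g c \<omega>. g \<in> carrier G \<Longrightarrow> \<phi> g = lift c (\<pi> g) \<Longrightarrow> \<omega> \<in> \<Omega> \<Longrightarrow>
      [c \<omega> = d (\<pi> g \<omega>) - d \<omega> + \<chi> g] (mod int p)"
    and x: "x \<in> carrier G" "\<chi> x \<noteq> 0"
  shows "p dvd card \<Omega>" "image_group G U \<phi> \<cong> integer_mod_group p \<times>\<times> Q"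
proof -
  have p0: "p > 0" using prime prime_gt_0_nat by blast
  let ?Z = "integer_mod_group p"
  interpret \<chi>: group_hom G ?Z \<chi>
    using \<chi> by (simp add: group_hom_def group_hom_axioms_def)
  have \<chi>_range: "0 \<le> \<chi> g" "\<chi> g < int p" if "g \<in> carrier G" for g
    using \<chi>.hom_closed[OF that] p0 by (simp_all add: carrier_integer_mod_group)
  have \<chi>_x: "\<not> int p dvd \<chi> x"
    using \<chi>_range[OF x(1)] x(2) zdvd_imp_le by fastforce
  have "\<chi> ` carrier G = carrier ?Z"
  proof
    show "carrier ?Z \<subseteq> \<chi> ` carrier G"
    proof
      fix a assume "a \<in> carrier ?Z"
      then have a: "a mod int p = a" using p0 by (simp add: carrier_integer_mod_group)
      have "coprime (\<chi> x) (int p)"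
        using \<chi>_x prime by (metis coprime_commute prime_imp_coprime prime_nat_int_transfer)
      then obtain m where "[\<chi> x * m = 1] (mod int p)" using cong_solve_coprime_int by blast
      then have m: "[m * a * \<chi> x = a] (mod int p)" unfolding cong_iff_dvd_diff by algebra
      have "\<chi> (x [^] nat (m * a mod int p)) = (int (nat (m * a mod int p)) * \<chi> x) mod int p"
        using \<chi>.hom_nat_pow[OF x(1)] by simp
      also have "\<dots> = (m * a * \<chi> x) mod int p" using p0 by (simp add: mod_mult_left_eq)
      also have "\<dots> = a" using m a by (simp add: cong_def)
      finally show "a \<in> \<chi> ` carrier G" using x(1) by (metis G.nat_pow_closed imageI)
    qed
  qed auto
  then have onto: "(\<lambda>g. (\<chi> g, \<iota> (\<pi> g))) ` carrier G = carrier (?Z \<times>\<times> Q)"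
    by (intro hom_pair_onto G.group_axioms Q Q_perfect abelian_integer_mod_group \<iota>\<pi>_hom \<iota>\<pi>_onto \<chi>)
  show "image_group G U \<phi> \<cong> ?Z \<times>\<times> Q"
    unfolding image_group_def
  proof (rule iso_image_of_same_fibres[OF G.group_axioms \<phi> _ onto])
    show "(\<lambda>g. (\<chi> g, \<iota> (\<pi> g))) \<in> hom G (?Z \<times>\<times> Q)"
      using \<chi> \<iota>\<pi>_hom by (auto simp: hom_def Pi_iff)
    fix g h assume gh: "g \<in> carrier G" "h \<in> carrier G"
    obtain c c' where c: "\<phi> g = lift c (\<pi> g)" "\<phi> h = lift c' (\<pi> h)" using \<phi>_lift gh by blast
    obtain \<omega>\<^sub>0 where w0: "\<omega>\<^sub>0 \<in> \<Omega>" by (rule fresh_point[of "[]"]) auto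
    have cc: "[c \<omega> = c' \<omega>] (mod int p) \<longleftrightarrow> \<chi> g = \<chi> h" if "\<pi> g = \<pi> h" and w: "\<omega> \<in> \<Omega>" for \<omega>
    proof -
      have "[c \<omega> = c' \<omega>] (mod int p) \<longleftrightarrow>
          [d (\<pi> g \<omega>) - d \<omega> + \<chi> g = d (\<pi> h \<omega>) - d \<omega> + \<chi> h] (mod int p)"
        using d[OF gh(1) c(1) w] d[OF gh(2) c(2) w] by (metis cong_sym cong_trans)
      also have "\<dots> \<longleftrightarrow> [\<chi> g = \<chi> h] (mod int p)" using that by (simp add: cong_add_lcancel)
      also have "\<dots> \<longleftrightarrow> \<chi> g = \<chi> h" using \<chi>_range gh by (simp add: cong_def)
      finally show ?thesis .
    qed
    have "\<phi> g = \<phi> h \<longleftrightarrow> \<pi> g = \<pi> h \<and> (\<forall>\<omega>\<in>\<Omega>. [c \<omega> = c' \<omega>] (mod int p))"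
      using c gh by (simp add: lift_eq_iff \<pi>_permutes)
    also have "\<dots> \<longleftrightarrow> \<pi> g = \<pi> h \<and> \<chi> g = \<chi> h" using cc w0 by blast
    finally show "\<phi> g = \<phi> h \<longleftrightarrow> (\<chi> g, \<iota> (\<pi> g)) = (\<chi> h, \<iota> (\<pi> h))"
      using \<iota>_eq_iff[OF gh] by auto
  qed
  have "(\<chi> x, \<iota> (\<pi> \<one>)) \<in> (\<lambda>g. (\<chi> g, \<iota> (\<pi> g))) ` carrier G"
    unfolding onto using hom_in_carrier[OF \<iota>\<pi>_hom G.one_closed] x(1) by (simp del: \<pi>.hom_one)
  then obtain z where z: "z \<in> carrier G" "\<chi> z = \<chi> x" "\<iota> (\<pi> z) = \<iota> (\<pi> \<one>)" by auto
  then have \<pi>z: "\<pi> z = id" using \<iota>_eq_iff[OF z(1) G.one_closed] \<pi>.hom_one by (simp add: Sym_def)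
  obtain c where c: "[(\<Sum>\<omega>\<in>\<Omega>. c \<omega>) = 0] (mod int p)" "\<phi> z = lift c (\<pi> z)" using \<phi>_lift z(1) by blast
  have "[(\<Sum>\<omega>\<in>\<Omega>. c \<omega>) = (\<Sum>\<omega>\<in>\<Omega>. \<chi> x)] (mod int p)"
    using d[OF z(1) c(2)] \<pi>z z(2) by (intro cong_sum) simp
  from cong_trans[OF cong_sym[OF this] c(1)] have "[int (card \<Omega>) * \<chi> x = 0] (mod int p)"
    by simp
  then have "int p dvd int (card \<Omega>) * \<chi> x" by (simp add: cong_iff_dvd_diff)
  then have "int p dvd int (card \<Omega>)"
    using \<chi>_x prime prime_dvd_mult_iff[of "int p"] by simp
  then show "p dvd card \<Omega>" by simp
qed

end

context zero_sum_cover
begin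

text \<open>
  When the kernel consists of constants, the coboundary term \<open>d (\<pi> x a) - d a\<close> vanishes at the fixed point
  \<open>a\<close>, so \<open>\<chi> x\<close> agrees modulo \<open>p\<close> with the shift \<open>c a\<close>, which is nonzero.
\<close>

lemma image_dichotomy:
  assumes Q_perfect: "derived Q (carrier Q) = carrier Q"
    and x: "x \<in> carrier G" "\<phi> x = lift c (\<pi> x)"
    and a: "a \<in> \<Omega>" "\<pi> x a = a" "\<not> [c a = 0] (mod int p)"
  shows "(\<exists>\<chi>\<in>hom G (integer_mod_group p). \<chi> x \<noteq> 0) \<and> p dvd card \<Omega> \<and>
      image_group G U \<phi> \<cong> integer_mod_group p \<times>\<times> Q \<or>
    is_semidirect (image_group G U \<phi>) (product_group {..<card \<Omega> - 1} (\<lambda>_. integer_mod_group p)) Q"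
proof (cases "\<forall>c. realized c id \<longrightarrow> (\<forall>\<alpha>\<in>\<Omega>. \<forall>\<beta>\<in>\<Omega>. [c \<alpha> = c \<beta>] (mod int p))")
  case True
  then obtain \<chi> d where \<chi>: "\<chi> \<in> hom G (integer_mod_group p)"
    and d: "\<And>g c \<omega>. g \<in> carrier G \<Longrightarrow> \<phi> g = lift c (\<pi> g) \<Longrightarrow> \<omega> \<in> \<Omega> \<Longrightarrow>
      [c \<omega> = d (\<pi> g \<omega>) - d \<omega> + \<chi> g] (mod int p)"
    using small_kernel_character by metis
  have "\<chi> x \<noteq> 0" using d[OF x a(1)] a(2,3) by auto
  then show ?thesis
    using nontrivial_character_direct_product[where d = d, OF Q_perfect \<chi> _ x(1)] \<chi> d by blast
next
  case False
  then obtain e \<alpha> \<beta> where "realized e id" "\<alpha> \<in> \<Omega>" "\<beta> \<in> \<Omega>" "\<not> [e \<alpha> = e \<beta>] (mod int p)" by blast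
  then have "realized d id" if "[(\<Sum>\<omega>\<in>\<Omega>. d \<omega>) = 0] (mod int p)" for d
    using kernel_contains_sum_zero[OF prime] that by blast
  then show ?thesis using full_kernel_semidirect by blast
qed

end

section \<open>Coordinates for the glued representation\<close>

context cyclic_cover
begin

text \<open>
  The gluing cycles belong to the wreath product: each rotates the fibre over a single point.
\<close>

lemma cycles_eq_lifts:
  assumes "p > 0" "a \<in> \<Omega>"
  defines "cs \<equiv> map (\<lambda>k. F (int k) a) [0..<p]"
  shows cycle_eq_lift: "cycle_of_list cs = lift (\<lambda>\<omega>. of_bool (\<omega> = a)) id"
    and rev_cycle_eq_lift: "cycle_of_list (rev cs) = lift (\<lambda>\<omega>. - of_bool (\<omega> = a)) id"
proof -
  have len: "length cs = p" by (simp add: cs_def)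
  have dist: "distinct cs"
    using assms(2) by (auto simp: cs_def distinct_map inj_on_def F_eq_iff cong_def)
  have rotation: "cycle_of_list ds (ds ! i) = ds ! (Suc i mod p)"
    if "distinct ds" "length ds = p" "i < p" for ds i
    using arg_cong[OF cyclic_rotation[OF that(1), of 1], of "\<lambda>l. l ! i"] that
    by (simp add: nth_rotate del: rotate_Suc)
  have nth: "F j a = cs ! nat (j mod int p)" for j
    using assms by (simp add: cs_def F_eq_iff nat_less_iff)
  have Suc_nat: "Suc (nat (j mod int p)) mod p = nat ((j + 1) mod int p)" for j
  proof -
    have "int (Suc (nat (j mod int p)) mod p) = (j mod int p + 1) mod int p"
      using assms(1) by (simp add: zmod_int add.commute)
    then show ?thesis by (simp add: mod_add_left_eq)
  qed
  have forward: "cycle_of_list cs (F j a) = F (j + 1) a" for j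
    using rotation[OF dist len, of "nat (j mod int p)"] assms(1)
    by (simp add: nth Suc_nat nat_less_iff)
  have rev_rotation: "cycle_of_list (rev cs) (cs ! (Suc i mod p)) = cs ! i" if i: "i < p" for i
  proof -
    define k where "k = p - 1 - Suc i mod p"
    have m: "Suc i mod p < p" using assms(1) by simp
    then have k: "k < p" "rev cs ! k = cs ! (Suc i mod p)"
      by (auto simp: k_def rev_nth len)
    have "rev cs ! (Suc k mod p) = cs ! i"
    proof (cases "Suc i = p")
      case True
      then have "Suc k = p" "i = p - 1" by (auto simp: k_def)
      then show ?thesis using assms(1) by (simp add: rev_nth len)
    next
      case False
      then have "Suc i mod p = Suc i" "Suc k = p - 1 - i" using i by (simp_all add: k_def)
      then show ?thesis using i by (simp add: rev_nth len)
    qed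
    then show ?thesis using rotation[of "rev cs" k] dist len k by simp
  qed
  have backward: "cycle_of_list (rev cs) (F j a) = F (j - 1) a" for j
    using rev_rotation[of "nat ((j - 1) mod int p)"] assms(1)
    by (simp add: nth Suc_nat nat_less_iff)
  have outside: "F j \<omega> \<notin> set cs" if "\<omega> \<in> \<Omega>" "\<omega> \<noteq> a" for j \<omega>
    using that assms(2) by (auto simp: cs_def F_eq_iff)
  have subset: "v \<notin> set cs" if "v \<notin> U" for v
    using that assms(2) by (auto simp: cs_def U_def)
  show "cycle_of_list cs = lift (\<lambda>\<omega>. of_bool (\<omega> = a)) id"
    using forward outside subset
    by (subst eq_lift_iff) (auto simp: permutes_id of_bool_def intro!: id_outside_supp)
  show "cycle_of_list (rev cs) = lift (\<lambda>\<omega>. - of_bool (\<omega> = a)) id"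
    using backward outside subset
    by (subst eq_lift_iff) (auto simp: permutes_id of_bool_def intro!: id_outside_supp)
qed

lemma zero_sum_lifts_generate:
  fixes G (structure)
  assumes "group G" "\<pi> \<in> hom G (Sym \<Omega>)" "\<phi> \<in> hom G (Sym U)" "S \<subseteq> carrier G"
    and gen: "\<And>s. s \<in> S \<Longrightarrow> \<exists>c. [(\<Sum>\<omega>\<in>\<Omega>. c \<omega>) = 0] (mod int p) \<and> \<phi> s = lift c (\<pi> s)"
    and g: "g \<in> generate G S"
  shows "\<exists>c. [(\<Sum>\<omega>\<in>\<Omega>. c \<omega>) = 0] (mod int p) \<and> \<phi> g = lift c (\<pi> g)"
proof -
  interpret group G by fact
  interpret \<pi>: group_hom G "Sym \<Omega>" \<pi>
    using assms(2) group_Sym by (simp add: group_hom_def group_hom_axioms_def)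
  interpret \<phi>: group_hom G "Sym U" \<phi>
    using assms(3) group_Sym by (simp add: group_hom_def group_hom_axioms_def)
  have perm: "\<pi> h permutes \<Omega>" if "h \<in> carrier G" for h
    using \<pi>.hom_closed[OF that] by (simp add: Sym_def)
  show ?thesis
    using g
  proof (induction rule: generate.induct)
    case one
    show ?case
      using \<pi>.hom_one \<phi>.hom_one lift_id by (intro exI[of _ "\<lambda>_. 0"]) (simp add: Sym_def id_def)
  next
    case (incl h)
    then show ?case by (rule gen)
  next
    case (inv h)
    then have h: "h \<in> carrier G" using assms(4) by blast
    obtain c where c: "[(\<Sum>\<omega>\<in>\<Omega>. c \<omega>) = 0] (mod int p)" "\<phi> h = lift c (\<pi> h)" using gen inv by blast
    have "(\<Sum>\<omega>\<in>\<Omega>. - c (inv' (\<pi> h) \<omega>)) = - (\<Sum>\<omega>\<in>\<Omega>. c \<omega>)"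
      using sum.permute[OF permutes_inv[OF perm[OF h]], of c] by (simp add: sum_negf comp_def)
    moreover have "\<phi> (inv h) = lift (\<lambda>\<omega>. - c (inv' (\<pi> h) \<omega>)) (\<pi> (inv h))"
      using h by (simp add: c(2) inv_Sym lift_permutes perm lift_inverse)
    moreover have "[- (\<Sum>\<omega>\<in>\<Omega>. c \<omega>) = 0] (mod int p)" using c(1) by (simp add: cong_iff_dvd_diff)
    ultimately show ?case by (intro exI[of _ "\<lambda>\<omega>. - c (inv' (\<pi> h) \<omega>)"]) simp
  next
    case (eng h k)
    then have hk: "h \<in> carrier G" "k \<in> carrier G"
      using generate_in_carrier[OF assms(4)] by auto
    obtain c where c: "[(\<Sum>\<omega>\<in>\<Omega>. c \<omega>) = 0] (mod int p)" "\<phi> h = lift c (\<pi> h)" using eng by blast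
    obtain d where d: "[(\<Sum>\<omega>\<in>\<Omega>. d \<omega>) = 0] (mod int p)" "\<phi> k = lift d (\<pi> k)" using eng by blast
    have "(\<Sum>\<omega>\<in>\<Omega>. c \<omega> + d (\<pi> h \<omega>)) = (\<Sum>\<omega>\<in>\<Omega>. c \<omega>) + (\<Sum>\<omega>\<in>\<Omega>. d \<omega>)"
      using sum.permute[OF perm[OF hk(1)], of d] by (simp add: sum.distrib comp_def)
    moreover have "\<phi> (h \<otimes> k) = lift (\<lambda>\<omega>. c \<omega> + d (\<pi> h \<omega>)) (\<pi> (h \<otimes> k))"
      using lift_compose[OF perm[OF hk(1)] perm[OF hk(2)], of d c] hk c(2) d(2) by (simp add: Sym_def)
    ultimately show ?case
      using cong_add[OF c(1) d(1)] by (intro exI[of _ "\<lambda>\<omega>. c \<omega> + d (\<pi> h \<omega>)"]) simp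
  qed
qed

end

lemma list_mult_Sym_disjoint:
  assumes "disjoint_family_on S I" "\<And>i. i \<in> I \<Longrightarrow> h i permutes S i"
    and "distinct js" "set js \<subseteq> I" "i \<in> I" "u \<in> S i"
  shows "list_mult (Sym T) (map h js) u = (if i \<in> set js then h i u else u)"
  using assms(3-6)
proof (induction js arbitrary: u)
  case Nil
  then show ?case by (simp add: list_mult_def Sym_def)
next
  case (Cons j js)
  have step: "list_mult (Sym T) (map h (j # js)) u = list_mult (Sym T) (map h js) (h j u)"
    by (simp add: list_mult_def Sym_def)
  show ?case
  proof (cases "j = i")
    case True
    then have "h j u \<in> S i" using Cons.prems assms(2) permutes_in_image by metis
    then show ?thesis unfolding step using Cons True by simp
  next
    case False
    then have "u \<notin> S j" using Cons.prems assms(1) by (auto simp: disjoint_family_on_def)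
    then have "h j u = u" using Cons.prems assms(2)[of j] by (simp add: permutes_not_in)
    then show ?thesis unfolding step using Cons False by simp
  qed
qed

section \<open>Triangle groups\<close>

lemma inv_word_class_letter:
  "inv\<^bsub>presented_group R\<^esub> word_class R [(s, e)] = word_class R [(s, \<not> e)]"
proof (rule group.inv_equality[OF group_presented_group])
  show "word_class R [(s, \<not> e)] \<otimes>\<^bsub>presented_group R\<^esub> word_class R [(s, e)] = \<one>\<^bsub>presented_group R\<^esub>"
    using word_eq.cancel[of R "[]" s "\<not> e" "[]"]
    by (simp add: presented_group_mult word_class_eq_iff) (simp add: presented_group_def word_class_eq_iff)
qed (simp_all add: presented_group_def)

lemma presented_group_generated:
  "carrier (presented_group R) = generate (presented_group R) (range (\<lambda>s. word_class R [(s, True)]))"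
    (is "_ = generate ?G ?S")
proof
  interpret group ?G by (rule group_presented_group)
  show "generate ?G ?S \<subseteq> carrier ?G"
    by (rule generate_incl) (auto simp: presented_group_def)
  have "word_class R u \<in> generate ?G ?S" for u
  proof (induction u)
    case Nil
    show ?case using generate.one[of ?G ?S] by (simp add: presented_group_def)
  next
    case (Cons l u)
    obtain s e where l: "l = (s, e)" by fastforce
    have "word_class R [(s, True)] \<in> generate ?G ?S" by (intro generate.incl) simp
    moreover have "inv\<^bsub>?G\<^esub> word_class R [(s, True)] \<in> generate ?G ?S" by (intro generate.inv) simp
    ultimately have "word_class R [l] \<in> generate ?G ?S"
      by (cases e) (simp_all add: l inv_word_class_letter)
    from generate.eng[OF this Cons.IH] show ?case by (simp add: presented_group_mult)
  qed
  then show "carrier ?G \<subseteq> generate ?G ?S" by (auto simp: presented_group_def)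
qed

lemma word_class_pow:
  "word_class R u [^]\<^bsub>presented_group R\<^esub> (m::nat) = word_class R (concat (replicate m u))"
proof -
  interpret group "presented_group R" by (rule group_presented_group)
  have one: "word_class R [] = \<one>\<^bsub>presented_group R\<^esub>" by (simp add: presented_group_def)
  have "word_class R u \<in> carrier (presented_group R)" by (simp add: presented_group_def)
  then show ?thesis
  proof (induction m)
    case 0
    show ?case by (simp add: one)
  next
    case (Suc m)
    then show ?case by (simp only: nat_pow_Suc2 replicate_Suc concat.simps presented_group_mult)
  qed
qed

lemma triangle_group_facts:
  shows tri_x_closed: "tri_x p q r \<in> carrier \<Delta>(p, q, r)"
    and tri_y_closed: "tri_y p q r \<in> carrier \<Delta>(p, q, r)"
    and tri_y_pow: "tri_y p q r [^]\<^bsub>\<Delta>(p, q, r)\<^esub> q = \<one>\<^bsub>\<Delta>(p, q, r)\<^esub>"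
    and tri_xy_pow: "(tri_x p q r \<otimes>\<^bsub>\<Delta>(p, q, r)\<^esub> tri_y p q r) [^]\<^bsub>\<Delta>(p, q, r)\<^esub> r = \<one>\<^bsub>\<Delta>(p, q, r)\<^esub>"
    and triangle_group_generated: "carrier \<Delta>(p, q, r) = generate \<Delta>(p, q, r) {tri_x p q r, tri_y p q r}"
proof -
  let ?R = "triangle_relators p q r"
  have relator: "word_class ?R w = word_class ?R []" if "w \<in> ?R" for w
    using word_eq.relator[OF that, of "[]" "[]"] by (simp add: word_class_eq_iff)
  have concat_replicate: "concat (replicate m [s]) = replicate m s" for m and s :: "tri_gen \<times> bool"
    by (induction m) auto
  show "tri_x p q r \<in> carrier \<Delta>(p, q, r)" "tri_y p q r \<in> carrier \<Delta>(p, q, r)"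
    by (simp_all add: triangle_group_def tri_x_def tri_y_def presented_group_def)
  have one: "\<one>\<^bsub>\<Delta>(p, q, r)\<^esub> = word_class ?R []" by (simp add: triangle_group_def presented_group_def)
  show "tri_y p q r [^]\<^bsub>\<Delta>(p, q, r)\<^esub> q = \<one>\<^bsub>\<Delta>(p, q, r)\<^esub>"
    using relator[of "replicate q (Y, True)"]
    by (simp add: one) (simp add: triangle_group_def tri_y_def word_class_pow concat_replicate triangle_relators_def)
  show "(tri_x p q r \<otimes>\<^bsub>\<Delta>(p, q, r)\<^esub> tri_y p q r) [^]\<^bsub>\<Delta>(p, q, r)\<^esub> r = \<one>\<^bsub>\<Delta>(p, q, r)\<^esub>"
    using relator[of "concat (replicate r [(X, True), (Y, True)])"]
    by (simp add: one)
      (simp add: triangle_group_def tri_x_def tri_y_def presented_group_mult word_class_pow triangle_relators_def)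
  have "(UNIV :: tri_gen set) = {X, Y}" using tri_gen.exhaust by auto
  then have "range g = {g X, g Y}" for g :: "tri_gen \<Rightarrow> (tri_gen \<times> bool) list set"
    by (metis image_insert image_empty)
  then show "carrier \<Delta>(p, q, r) = generate \<Delta>(p, q, r) {tri_x p q r, tri_y p q r}"
    using presented_group_generated[of ?R] by (simp add: triangle_group_def tri_x_def tri_y_def)
qed

text \<open>
  If \<open>m\<close> does not divide \<open>q\<close>, the relation \<open>y\<^sup>q = 1\<close> forces \<open>\<chi> y = 0\<close>, and if it does not divide \<open>r\<close> either,
  \<open>(xy)\<^sup>r = 1\<close> forces \<open>\<chi> x + \<chi> y = 0\<close>.
\<close>

lemma triangle_character_at_x:
  assumes m: "prime m" and \<chi>: "\<chi> \<in> hom \<Delta>(p, q, r) (integer_mod_group m)"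
    and nonzero: "\<chi> (tri_x p q r) \<noteq> 0"
  shows "m dvd q * r"
proof (rule ccontr)
  let ?x = "tri_x p q r" and ?y = "tri_y p q r"
  assume "\<not> m dvd q * r"
  then have qr: "\<not> int m dvd int q" "\<not> int m dvd int r" using m by (auto simp: prime_dvd_mult_iff)
  have m': "prime (int m)" using m by simp
  have m0: "m > 0" using m prime_gt_0_nat by blast
  interpret \<chi>: group_hom "\<Delta>(p, q, r)" "integer_mod_group m" \<chi>
    using \<chi> group_triangle_group by (simp add: group_hom_def group_hom_axioms_def)
  note x = tri_x_closed[of p q r] and y = tri_y_closed[of p q r]
  have "(int q * \<chi> ?y) mod int m = 0"
    using \<chi>.hom_nat_pow[OF y, of q] by (simp add: tri_y_pow)
  then have y0: "int m dvd \<chi> ?y"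
    using qr m' by (simp add: mod_eq_0_iff_dvd prime_dvd_mult_iff)
  have "(int r * ((\<chi> ?x + \<chi> ?y) mod int m)) mod int m = 0"
    using \<chi>.hom_nat_pow[OF \<chi>.G.m_closed[OF x y], of r] x y by (simp add: tri_xy_pow)
  then have "int m dvd int r * (\<chi> ?x + \<chi> ?y)"
    by (simp add: mod_mult_right_eq mod_eq_0_iff_dvd)
  then have "int m dvd \<chi> ?x"
    using qr m' y0 by (simp add: prime_dvd_mult_iff dvd_add_left_iff)
  then show False
    using nonzero \<chi>.hom_closed[OF x] m0 zdvd_imp_le[of "int m" "\<chi> ?x"]
    by (force simp: carrier_integer_mod_group)
qed

text \<open>
  A 3-cycle is the square of its inverse.
\<close>

lemma three_cycle_in_index_two:
  assumes "finite S" "subgroup P (Sym S)" "2 * card P = fact (card S)"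
    and abc: "distinct [\<alpha>, \<beta>, \<gamma>]" "{\<alpha>, \<beta>, \<gamma>} \<subseteq> S"
  shows "cycle_of_list [\<alpha>, \<beta>, \<gamma>] \<in> P"
proof -
  have "{g. g permutes S} = carrier (Sym S)" by (simp add: Sym_def)
  then have "finite (carrier (Sym S))" "card (carrier (Sym S)) = fact (card S)"
    using finite_permutations[OF assms(1)] card_permutations[OF HOL.refl assms(1)] by simp_all
  moreover have "cycle_of_list [\<beta>, \<alpha>, \<gamma>] \<in> carrier (Sym S)"
    using permutes_subset[OF cycle_permutes[of "[\<beta>, \<alpha>, \<gamma>]"]] abc(2) by (simp add: Sym_def)
  ultimately have "cycle_of_list [\<beta>, \<alpha>, \<gamma>] \<otimes>\<^bsub>Sym S\<^esub> cycle_of_list [\<beta>, \<alpha>, \<gamma>] \<in> P"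
    using assms by (intro index_two_contains_squares[OF group_Sym]) simp_all
  moreover have "cycle_of_list [\<beta>, \<alpha>, \<gamma>] \<circ> cycle_of_list [\<beta>, \<alpha>, \<gamma>] = cycle_of_list [\<alpha>, \<beta>, \<gamma>]"
    using abc(1) by (auto simp: three_cycle_apply)
  ultimately show ?thesis by (simp add: Sym_def)
qed

section \<open>The image of the glued representation\<close>

theorem theorem5p1:
  fixes p q r n k :: nat
    and \<Omega> :: "'a set" and \<pi> :: "(tri_gen \<times> bool) list set \<Rightarrow> 'a \<Rightarrow> 'a" and a b :: 'a
    and \<Omega>' :: "nat \<Rightarrow> 'b set" and \<pi>' :: "nat \<Rightarrow> (tri_gen \<times> bool) list set \<Rightarrow> 'b \<Rightarrow> 'b"
    and f :: "nat \<Rightarrow> 'a \<Rightarrow> 'b" and \<phi> :: "(tri_gen \<times> bool) list set \<Rightarrow> 'b \<Rightarrow> 'b"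
  defines "G \<equiv> \<Delta>(p, q, r)" and "x \<equiv> tri_x p q r" and "y \<equiv> tri_y p q r"
    and "U \<equiv> (\<Union>i\<in>{1..p}. \<Omega>' i)"
    and "H \<equiv> image_group \<Delta>(p, q, r) (\<Union>i\<in>{1..p}. \<Omega>' i) \<phi>"
  assumes "prime p" and "p \<le> q" and "q \<le> r"
    and "finite \<Omega>" and "card \<Omega> = n" and "n > 6"
    and "transitive_rep G \<Omega> \<pi>"
    and "image_group G \<Omega> \<pi> \<cong> alt_group n"
    and "is_handle \<Omega> \<pi> x y k a b"
    and "disjoint_family_on \<Omega>' {1..p}"
    and "\<forall>i\<in>{1..p}. perm_rep G (\<Omega>' i) (\<pi>' i)"
    and "\<forall>i\<in>{1..p}. rep_equiv_via G \<Omega> \<pi> (\<Omega>' i) (\<pi>' i) (f i)"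
    and "perm_rep G U \<phi>"
    and "\<phi> x = list_mult (Sym U) (map (\<lambda>i. \<pi>' i x) [1..<p + 1])
                 \<otimes>\<^bsub>Sym U\<^esub> cycle_of_list (map (\<lambda>i. f i a) [1..<p + 1])
                 \<otimes>\<^bsub>Sym U\<^esub> cycle_of_list (rev (map (\<lambda>i. f i b) [1..<p + 1]))"
    and "\<phi> y = list_mult (Sym U) (map (\<lambda>i. \<pi>' i y) [1..<p + 1])"
  shows "(p dvd q * r \<and> p dvd n \<and> H \<cong> integer_mod_group p \<times>\<times> alt_group n) \<or>
         is_semidirect H (product_group {..<n - 1} (\<lambda>_. integer_mod_group p)) (alt_group n)"
proof -
  have p0: "p > 0" using \<open>prime p\<close> prime_gt_0_nat by blast
  have group_G: "group G" unfolding G_def by (rule group_triangle_group)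
  have x: "x \<in> carrier G" and y: "y \<in> carrier G"
    unfolding G_def x_def y_def by (rule tri_x_closed, rule tri_y_closed)
  have \<pi>: "\<pi> \<in> hom G (Sym \<Omega>)"
    using \<open>transitive_rep G \<Omega> \<pi>\<close> by (simp add: transitive_rep_def perm_rep_def)
  have ab: "a \<in> \<Omega>" "b \<in> \<Omega>" "a \<noteq> b" "\<pi> x a = a" "\<pi> x b = b"
    using \<open>is_handle \<Omega> \<pi> x y k a b\<close> by (simp_all add: is_handle_def)
  have \<pi>_permutes: "\<pi> g permutes \<Omega>" if "g \<in> carrier G" for g
    using hom_in_carrier[OF \<pi> that] by (simp add: Sym_def)
  have bij: "bij_betw (f i) \<Omega> (\<Omega>' i)"
    and equivariant: "\<And>\<omega> g. \<omega> \<in> \<Omega> \<Longrightarrow> g \<in> carrier G \<Longrightarrow> \<pi>' i g (f i \<omega>) = f i (\<pi> g \<omega>)"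
    and \<pi>'_permutes: "\<And>g. g \<in> carrier G \<Longrightarrow> \<pi>' i g permutes \<Omega>' i" if "i \<in> {1..p}" for i
    using assms(16,17) that by (auto simp: rep_equiv_via_def perm_rep_def hom_def Sym_def Pi_iff)
  \<comment> \<open>The copies are numbered from 1 to p, so residue 0 is the first copy.\<close>
  define sheet where "sheet j = nat (j mod int p) + 1" for j
  have sheet: "sheet j \<in> {1..p}" for j
    using p0 by (simp add: sheet_def Suc_le_eq nat_less_iff)
  have sheet_eq: "sheet i = sheet j \<longleftrightarrow> [i = j] (mod int p)" for i j
    using p0 by (simp add: sheet_def cong_def eq_nat_nat_iff)
  define F where "F j = f (sheet j)" for j
  interpret cover: cyclic_cover \<Omega> p F
  proof
    fix \<omega> \<omega>' i j assume w: "\<omega> \<in> \<Omega>" "\<omega>' \<in> \<Omega>"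
    show "F i \<omega> = F j \<omega>' \<longleftrightarrow> [i = j] (mod int p) \<and> \<omega> = \<omega>'"
    proof (cases "sheet i = sheet j")
      case True
      then have "F i = F j" "[i = j] (mod int p)" by (simp_all add: F_def sheet_eq[symmetric])
      then show ?thesis
        using bij[OF sheet, of j] w by (auto simp: F_def bij_betw_def inj_on_def)
    next
      case False
      then have "\<Omega>' (sheet i) \<inter> \<Omega>' (sheet j) = {}"
        using \<open>disjoint_family_on \<Omega>' {1..p}\<close> sheet by (simp add: disjoint_family_on_def)
      moreover have "F i \<omega> \<in> \<Omega>' (sheet i)" "F j \<omega>' \<in> \<Omega>' (sheet j)"
        using bij_betwE[OF bij[OF sheet]] w by (auto simp: F_def)
      ultimately show ?thesis using False sheet_eq by auto
    qed
  qed
  have F_of_nat: "f i = F (int (i - 1))" if "i \<in> {1..p}" for i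
    using that by (cases i) (simp_all add: F_def sheet_def)
  have U: "U = cover.U"
  proof
    show "U \<subseteq> cover.U"
    proof
      fix u assume "u \<in> U"
      then obtain i \<omega> where i: "i \<in> {1..p}" and "\<omega> \<in> \<Omega>" "u = f i \<omega>"
        using bij unfolding U_def bij_betw_def by blast
      then show "u \<in> cover.U" using F_of_nat[OF i] by (auto simp: cover.U_def)
    qed
    show "cover.U \<subseteq> U"
      using bij_betwE[OF bij[OF sheet]] sheet unfolding cover.U_def U_def F_def by blast
  qed
  have \<phi>: "\<phi> \<in> hom G (Sym cover.U)"
    using \<open>perm_rep G U \<phi>\<close> by (simp add: perm_rep_def U)
  have cycle_list: "map (\<lambda>i. f i \<omega>) [1..<p + 1] = map (\<lambda>k. F (int k) \<omega>) [0..<p]" for \<omega>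
    by (rule nth_equalityI) (simp_all add: F_of_nat del: upt_Suc)
  have product: "list_mult (Sym U) (map (\<lambda>i. \<pi>' i g) [1..<p + 1]) = cover.lift (\<lambda>_. 0) (\<pi> g)"
    if g: "g \<in> carrier G" for g
  proof (rule cover.eq_lift_iff[OF \<pi>_permutes[OF g], THEN iffD2], intro conjI ballI allI impI)
    have set: "set [1..<p + 1] = {1..p}" by auto
    fix \<omega> j assume "\<omega> \<in> \<Omega>"
    then show "list_mult (Sym U) (map (\<lambda>i. \<pi>' i g) [1..<p + 1]) (F j \<omega>) = F (j + 0) (\<pi> g \<omega>)"
      using list_mult_Sym_disjoint[OF \<open>disjoint_family_on \<Omega>' {1..p}\<close>, of "\<lambda>i. \<pi>' i g" "[1..<p + 1]" "sheet j" "F j \<omega>" U]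
        bij_betwE[OF bij[OF sheet]] sheet[of j] \<pi>'_permutes g equivariant set
      by (auto simp: F_def simp del: upt_Suc)
  next
    fix v assume v: "v \<notin> cover.U"
    have fixed: "list_mult (Sym U) (map (\<lambda>i. \<pi>' i g) js) v = v" if "set js \<subseteq> {1..p}" for js
      using that
    proof (induction js)
      case (Cons i js)
      have "v \<notin> \<Omega>' i" using v Cons.prems by (auto simp: U[symmetric] U_def)
      then have "\<pi>' i g v = v" using Cons.prems \<pi>'_permutes[of i g] g permutes_not_in[of "\<pi>' i g"] by simp
      then show ?case using Cons by (simp add: list_mult_def Sym_def)
    qed (simp add: list_mult_def Sym_def)
    show "list_mult (Sym U) (map (\<lambda>i. \<pi>' i g) [1..<p + 1]) v = v" by (rule fixed) auto
  qed
  \<comment> \<open>The shifts of \<phi> x; both cycles act after \<pi> x, which fixes a and b.\<close>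
  define c :: "'a \<Rightarrow> int" where "c \<omega> = of_bool (\<omega> = a) - of_bool (\<omega> = b)" for \<omega>
  have \<phi>_y: "\<phi> y = cover.lift (\<lambda>_. 0) (\<pi> y)"
    using assms(20) product[OF y] by simp
  have "\<phi> x = cover.lift (\<lambda>\<omega>. - of_bool (\<omega> = b)) id \<circ>
      (cover.lift (\<lambda>\<omega>. of_bool (\<omega> = a)) id \<circ> cover.lift (\<lambda>_. 0) (\<pi> x))"
    using assms(19) product[OF x]
    unfolding cycle_list cover.cycle_eq_lift[OF p0 ab(1)] cover.rev_cycle_eq_lift[OF p0 ab(2)]
    by (simp add: Sym_def)
  also have "\<dots> = cover.lift (\<lambda>\<omega>. of_bool (\<pi> x \<omega> = a) + - of_bool (\<pi> x \<omega> = b)) (\<pi> x)"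
    using \<pi>_permutes[OF x] by (simp add: cover.lift_compose permutes_id)
  also have "(\<lambda>\<omega>. of_bool (\<pi> x \<omega> = a) + - of_bool (\<pi> x \<omega> = b)) = c"
    using ab permutes_inj[OF \<pi>_permutes[OF x]] by (auto simp: c_def fun_eq_iff inj_def of_bool_def)
  finally have \<phi>_x: "\<phi> x = cover.lift c (\<pi> x)" .
  have c_sum: "(\<Sum>\<omega>\<in>\<Omega>. c \<omega>) = 0"
    using ab \<open>finite \<Omega>\<close> by (simp add: c_def sum_subtractf of_bool_def)
  have lifts: "\<exists>c. [(\<Sum>\<omega>\<in>\<Omega>. c \<omega>) = 0] (mod int p) \<and> \<phi> g = cover.lift c (\<pi> g)" if "g \<in> carrier G" for g
  proof (rule cover.zero_sum_lifts_generate[OF group_G \<pi> \<phi>])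
    show "g \<in> generate G {x, y}"
      using that triangle_group_generated unfolding G_def x_def y_def by blast
    show "{x, y} \<subseteq> carrier G" using x y by simp
    show "\<exists>c. [(\<Sum>\<omega>\<in>\<Omega>. c \<omega>) = 0] (mod int p) \<and> \<phi> s = cover.lift c (\<pi> s)" if "s \<in> {x, y}" for s
      using that \<phi>_x \<phi>_y c_sum
      by (metis cong_refl insertE singletonD sum.neutral)
  qed
  obtain \<iota> where \<iota>: "\<iota> \<in> iso (image_group G \<Omega> \<pi>) (alt_group n)"
    using \<open>image_group G \<Omega> \<pi> \<cong> alt_group n\<close> by (auto simp: is_iso_def)
  have subgroup: "subgroup (\<pi> ` carrier G) (Sym \<Omega>)"
    by (rule group_hom.img_is_subgroup) (simp add: group_hom_def group_hom_axioms_def group_G group_Sym \<pi>)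
  have "card (\<pi> ` carrier G) = card (carrier (alt_group n))"
    using \<iota> bij_betw_same_card by (fastforce simp: iso_def image_group_def)
  then have index: "2 * card (\<pi> ` carrier G) = fact (card \<Omega>)"
    using alt_group_card_carrier[of n] \<open>n > 6\<close> \<open>card \<Omega> = n\<close> by simp
  interpret zero_sum_cover \<Omega> p F G \<pi> \<phi> "alt_group n" \<iota>
  proof (intro zero_sum_cover.intro zero_sum_cover_axioms.intro cover.cyclic_cover_axioms group_G)
    show "cycle_of_list [\<alpha>, \<beta>, \<gamma>] \<in> \<pi> ` carrier G"
      if "distinct [\<alpha>, \<beta>, \<gamma>]" "{\<alpha>, \<beta>, \<gamma>} \<subseteq> \<Omega>" for \<alpha> \<beta> \<gamma>
      using three_cycle_in_index_two[OF \<open>finite \<Omega>\<close> subgroup index that] .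
    show "card \<Omega> > 6" using \<open>card \<Omega> = n\<close> \<open>n > 6\<close> by simp
  qed (fact \<open>prime p\<close> \<open>finite \<Omega>\<close> \<pi> \<phi> lifts alt_group_is_group \<iota>)+
  have "\<not> [c a = 0] (mod int p)"
    using ab(3) \<open>prime p\<close> by (auto simp: c_def cong_iff_dvd_diff)
  then have "(\<exists>\<chi>\<in>hom G (integer_mod_group p). \<chi> x \<noteq> 0) \<and> p dvd card \<Omega> \<and>
      image_group G cover.U \<phi> \<cong> integer_mod_group p \<times>\<times> alt_group n \<or>
    is_semidirect (image_group G cover.U \<phi>) (product_group {..<card \<Omega> - 1} (\<lambda>_. integer_mod_group p)) (alt_group n)"
    using image_dichotomy[OF derived_alt_group_const x \<phi>_x ab(1,4)] \<open>n > 6\<close> by simp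
  moreover have "H = image_group G cover.U \<phi>" by (simp add: H_def G_def U[symmetric] U_def)
  ultimately show ?thesis
    using triangle_character_at_x[OF \<open>prime p\<close>] \<open>card \<Omega> = n\<close> unfolding G_def x_def by auto
qed

end
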